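(* Consider the randomly switched system $\dot x=f_\sigma(x)$, $x(0)=x_0$, $t\ge0$, where $\sigma\sim(\pi^\circ,Q)$ is a continuous-time Markov chain, and let $$\overline q:=\max\{|q_{ii}| : i\in\mathcal{P}\},\qquad \widetilde q:=\max\{q_{ij} : i,j\in\mathcal{P}\}.$$ Suppose that there exist continuously differentiable functions $V_p:\mathbb{R}^n\to\mathbb{R}_{\ge0}$, $p\in\mathcal{P}$, functions $\alpha_1,\alpha_2\in\mathcal{K}_\infty$, and real numbers $\lambda_\circ>0$ and $\mu>1$, such that (i) $\alpha_1(\|x\|)\le V_p(x)\le\alpha_2(\|x\|)$ for all $x\in\mathbb{R}^n$, $p\in\mathcal{P}$; (ii) $\frac{\partial V_p}{\partial x}(x)f_p(x)\le-\lambda_\circ V_p(x)$ for all $x\in\mathbb{R}^n$, $p\in\mathcal{P}$; (iii) $V_{p_1}(x)\le\mu V_{p_2}(x)$ for all $x\in\mathbb{R}^n$, $p_1,p_2\in\mathcal{P}$; (iv) $\mu<(\lambda_\circ+\widetilde q)/\overline q$. Then the system is globally asymptotically stable almost surely.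
   Context: $\|\cdot\|$ is the Euclidean norm and $\mathbb{R}_{\ge 0}=[0,\infty[$. A continuous function $\alpha:\mathbb{R}_{\ge0}\to\mathbb{R}_{\ge0}$ is of class $\mathcal{K}$ if it is strictly increasing with $\alpha(0)=0$, and of class $\mathcal{K}_\infty$ if in addition $\alpha(r)\to\infty$ as $r\to\infty$. Setting: $\mathcal{P}=\{1,\ldots,\mathrm{N}\}$ is a finite index set; for each $p\in\mathcal{P}$, $f_p:\mathbb{R}^n\to\mathbb{R}^n$ is locally Lipschitz with $f_p(0)=0$. For every compact $K\subset\mathbb{R}_{\ge0}\times\mathbb{R}^n$ there is an integrable function $m_K$ with $\sup_{p\in\mathcal{P}}\|f_p(x)\|\le m_K(t)$ for all $(t,x)\in K$. $(\Omega,\mathfrak{F},(\mathfrak{F}_t)_{t\ge0},\mathsf{P})$ is a complete filtered probability space, and $(\mathfrak{F}_t)$ is the natural filtration (satisfying the usual conditions) generated by a càdlàg random process $\sigma$ taking values in $\mathcal{P}$. The notation $\sigma\sim(\pi^\circ,Q)$ means that $\sigma$ is the state of a continuous-time Markov chain on $\mathcal{P}$ with initial probability distribution $\pi^\circ$ and generator matrix $Q=[q_{ij}]_{\mathrm{N}\times\mathrm{N}}$, i.e. $q_{ij}\ge0$ for $i\ne j$, $\sum_{j\ne i}q_{ij}=-q_{ii}$, and $\mathsf{P}(\sigma(t+h)=j\mid\sigma(t)=i)=\delta_{ij}+q_{ij}h+o(h)$ for $h>0$. The randomly switched system is $\dot x(t)=f_{\sigma(t)}(x(t))$, $x(0)=x_0$,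 with $x_0\in\mathbb{R}^n$ deterministic and no jumps of $x$ at the switching instants (discontinuity times of $\sigma$). $x(\cdot)$ denotes its unique solution in the sense of Carathéodory (its existence on all of $[0,\infty[$ is a consequence of the hypotheses, not an additional assumption). The system is globally asymptotically stable almost surely if both of the following hold, where $x(\cdot)$ is the solution from initial condition $x_0$ and the implications are for all $x_0\in\mathbb{R}^n$: (SP1) $\mathsf{P}\big(\forall\varepsilon>0\ \exists\delta>0:\ \|x_0\|<\delta\Rightarrow \sup_{t\ge0}\|x(t)\|<\varepsilon\big)=1$; (SP2) $\mathsf{P}\big(\forall r,\varepsilon'>0\ \exists T\ge0:\ \|x_0\|<r\Rightarrow\sup_{t\ge T}\|x(t)\|<\varepsilon'\big)=1$. *)

theory Defs
  imports "HOL-Probability.Probability" "HOL-Library.Landau_Symbols"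
begin

section \<open>Comparison functions and smoothness\<close>

text \<open>Functions on the half-line are total functions on the reals of which only the
  restriction to nonnegative arguments matters; nonnegativity of the values follows from
  strict monotonicity and \<open>\<alpha> 0 = 0\<close>.\<close>

definition class_K :: "(real \<Rightarrow> real) \<Rightarrow> bool" where
  "class_K \<alpha> \<longleftrightarrow> continuous_on {0..} \<alpha> \<and> strict_mono_on {0..} \<alpha> \<and> \<alpha> 0 = 0"

definition class_K_infinity :: "(real \<Rightarrow> real) \<Rightarrow> bool" where
  "class_K_infinity \<alpha> \<longleftrightarrow> class_K \<alpha> \<and> filterlim \<alpha> at_top at_top"

definition continuously_differentiable ::
    "('a::real_normed_vector \<Rightarrow> 'b::real_normed_vector) \<Rightarrow> bool" where
  "continuously_differentiable V \<longleftrightarrow>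
     (\<exists>V' :: 'a \<Rightarrow> 'a \<Rightarrow>\<^sub>L 'b.
        (\<forall>x. (V has_derivative blinfun_apply (V' x)) (at x)) \<and> continuous_on UNIV V')"

section \<open>The switching process\<close>

text \<open>Index sets are \<open>{1..N}\<close>; a matrix is a function of two indices of which only the
  entries with both indices in \<open>{1..N}\<close> are used.\<close>

definition generator_matrix :: "nat \<Rightarrow> (nat \<Rightarrow> nat \<Rightarrow> real) \<Rightarrow> bool" where
  "generator_matrix N q \<longleftrightarrow>
     (\<forall>i\<in>{1..N}. (\<forall>j\<in>{1..N}. i \<noteq> j \<longrightarrow> q i j \<ge> 0) \<and> (\<Sum>j\<in>{1..N} - {i}. q i j) = - q i i)"

definition probability_vector :: "nat \<Rightarrow> (nat \<Rightarrow> real) \<Rightarrow> bool" where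
  "probability_vector N p \<longleftrightarrow> (\<forall>i\<in>{1..N}. p i \<ge> 0) \<and> (\<Sum>i\<in>{1..N}. p i) = 1"

definition cadlag_process :: "'w measure \<Rightarrow> nat \<Rightarrow> (real \<Rightarrow> 'w \<Rightarrow> nat) \<Rightarrow> bool" where
  "cadlag_process M N \<sigma> \<longleftrightarrow>
     (\<forall>t\<ge>0. \<sigma> t \<in> measurable M (count_space {1..N})) \<and>
     (\<forall>\<omega>\<in>space M.
        (\<forall>t\<ge>0. continuous (at_right t) (\<lambda>s. \<sigma> s \<omega>)) \<and>
        (\<forall>t>0. \<exists>l. ((\<lambda>s. \<sigma> s \<omega>) \<longlongrightarrow> l) (at_left t)))"

definition past_events :: "'w measure \<Rightarrow> (real \<Rightarrow> 'w \<Rightarrow> nat) \<Rightarrow> real \<Rightarrow> 'w set set" where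
  "past_events M \<sigma> t =
     sigma_sets (space M) {\<sigma> s -` B \<inter> space M | s B. 0 \<le> s \<and> s \<le> t}"

text \<open>The usual augmentation of the natural filtration: null sets are added, then the
  right limit is taken.\<close>

definition natural_filtration ::
    "'w measure \<Rightarrow> (real \<Rightarrow> 'w \<Rightarrow> nat) \<Rightarrow> (real \<Rightarrow> 'w measure) \<Rightarrow> bool" where
  "natural_filtration M \<sigma> F \<longleftrightarrow>
     (\<forall>t\<ge>0. space (F t) = space M \<and>
        sets (F t) = (\<Inter>s\<in>{t<..}. sigma_sets (space M) (past_events M \<sigma> s \<union> null_sets M)))"

text \<open>The four clauses after the conditions on \<open>\<pi>\<close> and \<open>q\<close> are: the initial distribution, the
  Markov property, homogeneity in time, and the generator. Homogeneity cannot be dropped: the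
  infinitesimal condition at each fixed \<open>t\<close> alone does not exclude additional jumps at
  deterministic times. All conditions on conditional probabilities are restricted to
  conditioning events of positive probability.\<close>

definition markov_chain ::
    "'w measure \<Rightarrow> nat \<Rightarrow> (real \<Rightarrow> 'w \<Rightarrow> nat) \<Rightarrow> (nat \<Rightarrow> real) \<Rightarrow> (nat \<Rightarrow> nat \<Rightarrow> real) \<Rightarrow> bool" where
  "markov_chain M N \<sigma> \<pi> q \<longleftrightarrow>
     probability_vector N \<pi> \<and> generator_matrix N q \<and>
     (\<forall>i\<in>{1..N}. \<P>(\<omega> in M. \<sigma> 0 \<omega> = i) = \<pi> i) \<and>
     (\<forall>t\<ge>0. \<forall>h>0. \<forall>A\<in>past_events M \<sigma> t. \<forall>i\<in>{1..N}. \<forall>j\<in>{1..N}.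
        \<P>(\<omega> in M. \<omega> \<in> A \<and> \<sigma> t \<omega> = i) > 0 \<longrightarrow>
        \<P>(\<omega> in M. \<sigma> (t + h) \<omega> = j \<bar> \<omega> \<in> A \<and> \<sigma> t \<omega> = i)
          = \<P>(\<omega> in M. \<sigma> (t + h) \<omega> = j \<bar> \<sigma> t \<omega> = i)) \<and>
     (\<forall>s\<ge>0. \<forall>t\<ge>0. \<forall>h>0. \<forall>i\<in>{1..N}. \<forall>j\<in>{1..N}.
        \<P>(\<omega> in M. \<sigma> s \<omega> = i) > 0 \<longrightarrow> \<P>(\<omega> in M. \<sigma> t \<omega> = i) > 0 \<longrightarrow>
        \<P>(\<omega> in M. \<sigma> (s + h) \<omega> = j \<bar> \<sigma> s \<omega> = i)
          = \<P>(\<omega> in M. \<sigma> (t + h) \<omega> = j \<bar> \<sigma> t \<omega> = i)) \<and>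
     (\<forall>t\<ge>0. \<forall>i\<in>{1..N}. \<forall>j\<in>{1..N}.
        \<P>(\<omega> in M. \<sigma> t \<omega> = i) > 0 \<longrightarrow>
        (\<lambda>h. \<P>(\<omega> in M. \<sigma> (t + h) \<omega> = j \<bar> \<sigma> t \<omega> = i)
               - ((if i = j then 1 else 0) + q i j * h)) \<in> o[at_right 0](\<lambda>h. h))"

section \<open>Solutions and stability\<close>

definition abs_continuous_on_interval :: "real \<Rightarrow> real \<Rightarrow> (real \<Rightarrow> 'a::metric_space) \<Rightarrow> bool" where
  "abs_continuous_on_interval a b x \<longleftrightarrow>
     (\<forall>\<epsilon>>0. \<exists>\<delta>>0. \<forall>D :: (real \<times> real) set.
        finite D \<and> (\<forall>(u, v)\<in>D. a \<le> u \<and> u \<le> v \<and> v \<le> b) \<and>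
        disjoint_family_on (\<lambda>(u, v). {u<..<v}) D \<and> (\<Sum>(u, v)\<in>D. v - u) < \<delta>
        \<longrightarrow> (\<Sum>(u, v)\<in>D. dist (x u) (x v)) < \<epsilon>)"

text \<open>Solutions of \<open>x' = f\<^bsub>s(t)\<^esub>(x)\<close>, \<open>x(0) = x0\<close> in the sense of Caratheodory on the half-line,
  for one realisation \<open>s\<close> of the switching signal. The values at negative times are irrelevant.\<close>

definition caratheodory_solution ::
    "(nat \<Rightarrow> 'a::real_normed_vector \<Rightarrow> 'a) \<Rightarrow> (real \<Rightarrow> nat) \<Rightarrow> 'a \<Rightarrow> (real \<Rightarrow> 'a) \<Rightarrow> bool" where
  "caratheodory_solution f s x0 x \<longleftrightarrow>
     x 0 = x0 \<and>
     (\<forall>T\<ge>0. abs_continuous_on_interval 0 T x) \<and>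
     (AE t in lborel. t \<ge> 0 \<longrightarrow> (x has_vector_derivative f (s t) (x t)) (at t))"

definition unique_caratheodory_solution ::
    "(nat \<Rightarrow> 'a::real_normed_vector \<Rightarrow> 'a) \<Rightarrow> (real \<Rightarrow> nat) \<Rightarrow> 'a \<Rightarrow> (real \<Rightarrow> 'a) \<Rightarrow> bool" where
  "unique_caratheodory_solution f s x0 x \<longleftrightarrow>
     caratheodory_solution f s x0 x \<and>
     (\<forall>y. caratheodory_solution f s x0 y \<longrightarrow> (\<forall>t\<ge>0. y t = x t))"

text \<open>Here \<open>x x0 \<omega> t\<close> is the state at time \<open>t\<close> of the solution started at \<open>x0\<close> in the
  realisation \<open>\<omega>\<close>. The initial condition is quantified inside the events, so the exceptional null
  set does not depend on it. Suprema are extended reals because the real \<open>Sup\<close> is unspecified on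
  unbounded sets.\<close>

definition globally_asymptotically_stable_as ::
    "'w measure \<Rightarrow> ('a::real_normed_vector \<Rightarrow> 'w \<Rightarrow> real \<Rightarrow> 'a) \<Rightarrow> bool" where
  "globally_asymptotically_stable_as M x \<longleftrightarrow>
     \<P>(\<omega> in M. \<forall>\<epsilon>>0. \<exists>\<delta>>0. \<forall>x0. norm x0 < \<delta> \<longrightarrow>
        (SUP t\<in>{0..}. ereal (norm (x x0 \<omega> t))) < ereal \<epsilon>) = 1 \<and>
     \<P>(\<omega> in M. \<forall>r>0. \<forall>\<epsilon>>0. \<exists>T\<ge>0. \<forall>x0. norm x0 < r \<longrightarrow>
        (SUP t\<in>{T..}. ereal (norm (x x0 \<omega> t))) < ereal \<epsilon>) = 1"

end

theory Submission
  imports Defs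
begin

text \<open>
  Let \<open>N(t)\<close> be the number of switches up to time \<open>t\<close>. Between two switches \<open>V\<^bsub>p\<^esub>\<close> decays
  exponentially with rate \<open>\<lambda>\<close> along the active mode, and at a switch the value of the active
  function grows at most by the factor \<open>\<mu>\<close>. So every trajectory satisfies
  \<open>V\<^bsub>\<sigma>(t)\<^esub>(x(t)) \<le> \<mu>\<^bsup>N(t)\<^esup> exp (- \<lambda> t) V\<^bsub>\<sigma>(0)\<^esub>(x\<^sub>0)\<close>, and the random factor in front of
  \<open>V\<^bsub>\<sigma>(0)\<^esub>(x\<^sub>0)\<close> is the same for all initial states.

  The chain leaves each state with rate at most \<open>q_bar\<close>, so \<open>N\<close> is dominated by a Poisson process
  of that rate, and the expectation of \<open>\<mu>\<^bsup>N(t)\<^esup>\<close> is at most \<open>exp ((\<mu> - 1) q_bar t)\<close> up to an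
  arbitrarily small increase of the rate. An entry of the generator never exceeds the exit rate of
  its row, hence \<open>q_tilde \<le> q_bar\<close>, and the hypothesis on \<open>\<mu>\<close> yields \<open>(\<mu> - 1) q_bar < \<lambda>\<close>. Thus
  the expectations of \<open>\<mu>\<^bsup>N(T)\<^esup> exp (- \<lambda> T)\<close> over the integers \<open>T\<close> have a finite sum, and these
  random variables tend to zero almost surely. Since \<open>N\<close> is increasing, this controls all real
  times, and the bounds by \<open>\<alpha>\<^sub>1\<close> and \<open>\<alpha>\<^sub>2\<close> turn it into both stability properties.

  The count is made on dyadic grids. A path on a bounded interval is a step function, so every cell
  of a sufficiently fine grid contains at most one switch, and for such grids the number of cells
  with different states at their ends gives the decay estimate (\<open>switched_decay\<close>). On a grid the
  Markov property gives the exponential moment one step at a time (\<open>expectation_grid_switches\<close>),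
  and Fatou's lemma carries it over to the limit inferior over the grids (\<open>grid_switches_growth\<close>).

  Solutions must exist for every path, including those for which the factor above is unbounded.
  The vector fields are cut off outside a large ball. The resulting bounded Lipschitz problem is
  solved on the whole half-line by a contraction argument (\<open>bounded_lipschitz_ivp\<close>). The Lyapunov
  functions do not increase between switches for the cut-off fields either, so a solution does not
  leave the ball before a prescribed time if the ball is large enough (\<open>solution_upto\<close>). Solutions
  for different horizons agree by uniqueness, which rests on the mean value inequality for
  absolutely continuous functions (\<open>abs_continuous_norm_diff_le\<close>).
\<close>

section \<open>Absolutely continuous functions\<close>

text \<open>The systems of nonoverlapping intervals over which an absolutely continuous function has small
  total variation.\<close>

definition short_intervals :: "real \<Rightarrow> real \<Rightarrow> real \<Rightarrow> (real \<times> real) set \<Rightarrow> bool" where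
  "short_intervals a b \<delta> D \<longleftrightarrow> finite D \<and> (\<forall>(u, v)\<in>D. a \<le> u \<and> u \<le> v \<and> v \<le> b) \<and>
     disjoint_family_on (\<lambda>(u, v). {u<..<v}) D \<and> (\<Sum>(u, v)\<in>D. v - u) < \<delta>"

lemma abs_continuous_on_interval_iff:
  "abs_continuous_on_interval a b y \<longleftrightarrow>
     (\<forall>e>0. \<exists>\<delta>>0. \<forall>D. short_intervals a b \<delta> D \<longrightarrow> (\<Sum>(u, v)\<in>D. dist (y u) (y v)) < e)"
  unfolding abs_continuous_on_interval_def short_intervals_def ..

text \<open>Elements of a tagged division have disjoint interiors, so those that lie in an open set of
  small measure have small total length. This bounds the contribution of the tags in a null set.\<close>

lemma tagged_elements_measure_le:
  fixes a b c :: real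
  assumes p: "p tagged_division_of {a..b}" and q: "q \<subseteq> p"
    and U: "open U" "emeasure lborel U \<le> ennreal c" "c \<ge> 0"
    and sub: "\<And>x K. (x, K) \<in> q \<Longrightarrow> K \<subseteq> U"
  shows "(\<Sum>(x, K)\<in>q. Sup K - Inf K) \<le> c"
proof -
  note pD = tagged_division_ofD[OF p]
  have fq: "finite q" using pD(1) q finite_subset by blast
  have K: "\<exists>u v. K = {u..v} \<and> u \<le> v" if "(x, K) \<in> q" for x K
    using pD(2,4)[of x K] that q by fastforce
  have len: "ennreal (Sup K - Inf K) = emeasure lborel (interior K)" if "(x, K) \<in> q" for x K
    using K[OF that] by (auto simp: interior_atLeastAtMost_real)
  have "ennreal (\<Sum>(x, K)\<in>q. Sup K - Inf K) = (\<Sum>(x, K)\<in>q. ennreal (Sup K - Inf K))"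
    unfolding case_prod_unfold
    by (rule sum_ennreal[symmetric]) (use K in fastforce)
  also have "\<dots> = (\<Sum>z\<in>q. emeasure lborel (interior (snd z)))"
    using len by (intro sum.cong) auto
  also have "\<dots> = emeasure lborel (\<Union>z\<in>q. interior (snd z))"
  proof (rule sum_emeasure)
    show "disjoint_family_on (\<lambda>z. interior (snd z)) q"
      unfolding disjoint_family_on_def using pD(5) q by (metis prod.collapse subsetD)
  qed (use fq in auto)
  also have "\<dots> \<le> emeasure lborel U"
    using sub U interior_subset by (intro emeasure_mono) fastforce+
  also have "\<dots> \<le> ennreal c" by fact
  finally show ?thesis using U(3) by (simp add: ennreal_le_iff)
qed

text \<open>A mean value inequality with a null set of exceptional points. Choose an open set \<open>U\<close> of small
  measure around the exceptional null set, and a gauge that is subordinate to \<open>U\<close> on the null set and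
  to the differential inequality elsewhere. In a fine tagged division the elements with a regular tag
  contribute at most \<open>(B + e) * (b - a)\<close>, and absolute continuity makes the contribution of the other
  elements small because they lie in \<open>U\<close>.\<close>

lemma abs_continuous_norm_diff_le:
  fixes y :: "real \<Rightarrow> 'a::real_normed_vector"
  assumes ac: "abs_continuous_on_interval a b y" and ab: "a \<le> b" and B: "B \<ge> 0"
    and der: "AE t in lborel. t \<in> {a..b} \<longrightarrow>
      (\<exists>D. (y has_vector_derivative D) (at t) \<and> norm D \<le> B)"
  shows "norm (y b - y a) \<le> B * (b - a)"
proof -
  have main: "norm (y b - y a) \<le> (B + e) * (b - a) + e" if e: "e > 0" for e
  proof -
    obtain \<delta> where \<delta>: "\<delta> > 0" and ac\<delta>: "\<forall>D. short_intervals a b \<delta> D \<longrightarrow> (\<Sum>(u, v)\<in>D. dist (y u) (y v)) < e"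
      using ac[unfolded abs_continuous_on_interval_iff, THEN spec, THEN mp, OF e]
      by (elim exE conjE) (rule that)
    obtain Z where Z: "Z \<in> null_sets lborel"
      and good: "\<And>t. t \<in> {a..b} \<Longrightarrow> t \<notin> Z \<Longrightarrow>
        \<exists>D. (y has_vector_derivative D) (at t) \<and> norm D \<le> B"
      using der by (auto elim!: AE_E3)
    obtain U where U: "open U" "Z \<subseteq> U" "emeasure lborel (U - Z) < ennreal (\<delta>/2)"
      using outer_regular_lborel[of Z "\<delta>/2"] Z \<delta> by (auto simp: null_sets_def)
    have Ule: "emeasure lborel U \<le> ennreal (\<delta>/2)"
      using emeasure_Diff_null_set[OF Z, of U] U by auto
    have "\<exists>d>0. \<forall>z. norm (z - t) < d \<longrightarrow> norm (y z - y t) \<le> (B + e) * norm (z - t)"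
      if t: "t \<in> {a..b}" "t \<notin> Z" for t
    proof -
      obtain D where D: "(y has_vector_derivative D) (at t)" "norm D \<le> B"
        using good t by blast
      then obtain d where d: "d > 0" "\<And>z. norm (z - t) < d \<Longrightarrow>
          norm (y z - y t - (z - t) *\<^sub>R D) \<le> e * norm (z - t)"
        using e unfolding has_vector_derivative_def has_derivative_at_alt by blast
      have "norm (y z - y t) \<le> (B + e) * norm (z - t)" if "norm (z - t) < d" for z
      proof -
        have "norm (y z - y t) \<le> norm (y z - y t - (z - t) *\<^sub>R D) + norm ((z - t) *\<^sub>R D)"
          by (metis diff_add_cancel norm_triangle_ineq)
        also have "\<dots> \<le> e * norm (z - t) + norm (z - t) * B"
          using d(2)[OF that] D(2) by (intro add_mono) (auto intro!: mult_left_mono)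
        finally show ?thesis by (simp add: algebra_simps)
      qed
      with d(1) show ?thesis by blast
    qed
    then obtain d where d: "\<And>t. t \<in> {a..b} \<Longrightarrow> t \<notin> Z \<Longrightarrow> d t > 0"
      "\<And>t z. t \<in> {a..b} \<Longrightarrow> t \<notin> Z \<Longrightarrow> norm (z - t) < d t \<Longrightarrow>
          norm (y z - y t) \<le> (B + e) * norm (z - t)"
      by metis
    define g where "g t = (if t \<in> Z then U else if t \<in> {a..b} then ball t (d t) else ball t 1)" for t
    have "gauge g" unfolding gauge_def g_def using U d(1) by auto
    then obtain p where p: "p tagged_division_of {a..b}" and fine: "g fine p"
      by (rule fine_division_exists_real)
    note pD = tagged_division_ofD[OF p]
    have K: "\<exists>u v. K = {u..v} \<and> u \<le> v \<and> a \<le> u \<and> v \<le> b \<and> u \<le> x \<and> x \<le> v"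
      if "(x, K) \<in> p" for x K
      using pD(2,3,4)[of x K] that by fastforce
    \<comment> \<open>Degenerate elements are left out so that an element is determined by its end points.\<close>
    define q where "q = {z \<in> p. fst z \<in> Z \<and> Inf (snd z) < Sup (snd z)}"
    have qp: "q \<subseteq> p" and fp: "finite p" and fq: "finite q" using pD(1) by (auto simp: q_def)
    define ends where "ends z = (Inf (snd z), Sup (snd z))" for z :: "real \<times> real set"
    have disj: "{Inf k<..<Sup k} \<inter> {Inf k'<..<Sup k'} = {}"
      if "(x, k) \<in> p" "(x', k') \<in> p" "(x, k) \<noteq> (x', k')" for x k x' k'
      using pD(5)[OF that] K[OF that(1)] K[OF that(2)] by (auto simp: interior_atLeastAtMost_real)
    have inj: "inj_on ends q"
    proof (rule inj_onI, rule ccontr)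
      fix z z' assume *: "z \<in> q" "z' \<in> q" "ends z = ends z'" "z \<noteq> z'"
      then have "{Inf (snd z)<..<Sup (snd z)} \<inter> {Inf (snd z')<..<Sup (snd z')} = {}"
        using disj[of "fst z" "snd z" "fst z'" "snd z'"] by (auto simp: q_def)
      with * show False by (auto simp: ends_def q_def)
    qed
    have sq: "(\<Sum>(x, k)\<in>q. dist (y (Inf k)) (y (Sup k))) < e"
    proof -
      have "(\<Sum>(u, v)\<in>ends ` q. dist (y u) (y v)) < e"
      proof (rule ac\<delta>[rule_format], unfold short_intervals_def, intro conjI)
        show "finite (ends ` q)" using fq by simp
        show "\<forall>(u, v)\<in>ends ` q. a \<le> u \<and> u \<le> v \<and> v \<le> b"
          using K qp by (fastforce simp: ends_def)
        show "disjoint_family_on (\<lambda>(u, v). {u<..<v}) (ends ` q)"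
          unfolding disjoint_family_on_def
        proof (intro ballI impI)
          fix m n assume "m \<in> ends ` q" "n \<in> ends ` q" and ne: "m \<noteq> n"
          then obtain z z' where z: "z \<in> q" "z' \<in> q" "m = ends z" "n = ends z'" by auto
          with ne have "z \<noteq> z'" by auto
          then show "(case m of (u, v) \<Rightarrow> {u<..<v}) \<inter> (case n of (u, v) \<Rightarrow> {u<..<v}) = {}"
            using disj[of "fst z" "snd z" "fst z'" "snd z'"] z qp by (auto simp: ends_def)
        qed
        have "(\<Sum>(u, v)\<in>ends ` q. v - u) = (\<Sum>(x, K)\<in>q. Sup K - Inf K)"
          by (subst sum.reindex[OF inj]) (auto simp: ends_def case_prod_unfold)
        also have "\<dots> \<le> \<delta>/2"
        proof (rule tagged_elements_measure_le[OF p qp U(1) Ule])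
          show "0 \<le> \<delta>/2" using \<delta> by simp
          show "K \<subseteq> U" if "(x, K) \<in> q" for x K
            using fineD[OF fine, of x K] that by (auto simp: q_def g_def)
        qed
        finally show "(\<Sum>(u, v)\<in>ends ` q. v - u) < \<delta>" using \<delta> by simp
      qed
      then show ?thesis
        by (subst (asm) sum.reindex[OF inj]) (auto simp: ends_def case_prod_unfold)
    qed
    have rest: "norm (y (Sup k) - y (Inf k)) \<le> (B + e) * (Sup k - Inf k)"
      if xk: "(x, k) \<in> p - q" for x k
    proof -
      obtain u v where uv: "k = {u..v}" "u \<le> v" "a \<le> u" "v \<le> b" "u \<le> x" "x \<le> v"
        using K[of x k] xk by auto
      show ?thesis
      proof (cases "x \<in> Z")
        case True
        with that uv show ?thesis by (auto simp: q_def)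
      next
        case False
        have xab: "x \<in> {a..b}" using uv by auto
        have "k \<subseteq> ball x (d x)" using fineD[OF fine, of x k] that False xab by (auto simp: g_def)
        then have "u \<in> ball x (d x)" "v \<in> ball x (d x)"
          using uv(1,2) atLeastAtMost_iff by blast+
        then have "norm (y v - y x) \<le> (B + e) * (v - x)" "norm (y u - y x) \<le> (B + e) * (x - u)"
          using d(2)[OF xab False, of v] d(2)[OF xab False, of u] uv
          by (auto simp: dist_real_def)
        then have "norm (y v - y u) \<le> (B + e) * (v - x) + (B + e) * (x - u)"
          using norm_triangle_ineq4[of "y v - y x" "y u - y x"] by simp
        then show ?thesis using uv by (simp add: algebra_simps)
      qed
    qed
    have nn: "0 \<le> (B + e) * (Sup k - Inf k)" if "(x, k) \<in> p" for x k
      using K[OF that] B e by auto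
    have "y b - y a = (\<Sum>(x, k)\<in>p. y (Sup k) - y (Inf k))"
      by (rule additive_tagged_division_1[OF ab p, symmetric])
    also have "norm \<dots> \<le> (\<Sum>(x, k)\<in>p. norm (y (Sup k) - y (Inf k)))"
      unfolding case_prod_unfold by (rule norm_sum)
    also have "\<dots> = (\<Sum>(x, k)\<in>p - q. norm (y (Sup k) - y (Inf k)))
        + (\<Sum>(x, k)\<in>q. norm (y (Sup k) - y (Inf k)))"
      by (rule sum.subset_diff[OF qp fp])
    also have "\<dots> \<le> (\<Sum>(x, k)\<in>p - q. (B + e) * (Sup k - Inf k)) + e"
      using sq rest by (intro add_mono sum_mono) (auto simp: dist_norm norm_minus_commute)
    also have "\<dots> \<le> (\<Sum>(x, k)\<in>p. (B + e) * (Sup k - Inf k)) + e"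
      using nn by (intro add_right_mono sum_mono2[OF fp]) auto
    also have "(\<Sum>(x, k)\<in>p. (B + e) * (Sup k - Inf k)) = (B + e) * (\<Sum>(x, k)\<in>p. Sup k - Inf k)"
      by (simp add: sum_distrib_left case_prod_unfold)
    also have "(\<Sum>(x, k)\<in>p. Sup k - Inf k) = b - a"
      by (rule additive_tagged_division_1[OF ab p])
    finally show ?thesis .
  qed
  show ?thesis
  proof (rule field_le_epsilon)
    fix r :: real assume r: "r > 0"
    define e where "e = r / (b - a + 1)"
    have "e > 0" using r ab by (simp add: e_def)
    from main[OF this] have "norm (y b - y a) \<le> B * (b - a) + e * (b - a + 1)"
      by (simp add: algebra_simps)
    then show "norm (y b - y a) \<le> B * (b - a) + r" using ab by (simp add: e_def)
  qed
qed

lemma abs_continuous_on_interval_singleD: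
  assumes "abs_continuous_on_interval a b y" "e > 0"
  obtains d where "d > 0" "\<And>u v. a \<le> u \<Longrightarrow> u \<le> v \<Longrightarrow> v \<le> b \<Longrightarrow> v - u < d \<Longrightarrow> dist (y u) (y v) < e"
proof -
  obtain d where d: "d > 0" and D: "\<forall>D. short_intervals a b d D \<longrightarrow> (\<Sum>(u, v)\<in>D. dist (y u) (y v)) < e"
    using assms(1)[unfolded abs_continuous_on_interval_iff, THEN spec, THEN mp, OF assms(2)]
    by (elim exE conjE) (rule that)
  show thesis
  proof (rule that[OF d])
    fix u v :: real assume "a \<le> u" "u \<le> v" "v \<le> b" "v - u < d"
    then show "dist (y u) (y v) < e"
      using D[THEN spec, of "{(u, v)}"] by (simp add: disjoint_family_on_def short_intervals_def)
  qed
qed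

lemma abs_continuous_imp_continuous_on:
  assumes "abs_continuous_on_interval a b y"
  shows "continuous_on {a..b} y"
  unfolding continuous_on_iff
proof (intro ballI allI impI)
  fix x e :: real assume x: "x \<in> {a..b}" and e: "e > 0"
  obtain d where d: "d > 0" "\<And>u v. a \<le> u \<Longrightarrow> u \<le> v \<Longrightarrow> v \<le> b \<Longrightarrow> v - u < d \<Longrightarrow> dist (y u) (y v) < e"
    using abs_continuous_on_interval_singleD[OF assms e] by blast
  have "dist (y x') (y x) < e" if "x' \<in> {a..b}" "dist x' x < d" for x'
    using d(2)[of x x'] d(2)[of x' x] x that
    by (cases "x \<le> x'") (auto simp: dist_real_def dist_commute)
  with d(1) show "\<exists>d>0. \<forall>x'\<in>{a..b}. dist x' x < d \<longrightarrow> dist (y x') (y x) < e" by blast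
qed

lemma abs_continuous_on_subinterval:
  assumes "abs_continuous_on_interval a b y" "a \<le> c" "d \<le> b"
  shows "abs_continuous_on_interval c d y"
  unfolding abs_continuous_on_interval_iff
proof (intro allI impI)
  fix e :: real assume e: "e > 0"
  obtain \<delta> where "\<delta> > 0" and D: "\<forall>D. short_intervals a b \<delta> D \<longrightarrow> (\<Sum>(u, v)\<in>D. dist (y u) (y v)) < e"
    using assms(1)[unfolded abs_continuous_on_interval_iff, THEN spec, THEN mp, OF e]
    by (elim exE conjE) (rule that)
  show "\<exists>\<delta>>0. \<forall>D. short_intervals c d \<delta> D \<longrightarrow> (\<Sum>(u, v)\<in>D. dist (y u) (y v)) < e"
  proof (rule exI[of _ \<delta>], intro conjI allI impI)
    fix E :: "(real \<times> real) set"
    assume *: "short_intervals c d \<delta> E"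
    then have "short_intervals a b \<delta> E"
      using assms(2,3) unfolding short_intervals_def by fastforce
    then show "(\<Sum>(u, v)\<in>E. dist (y u) (y v)) < e" using D by blast
  qed fact
qed

lemma abs_continuous_diff:
  fixes y z :: "real \<Rightarrow> 'a::real_normed_vector"
  assumes "abs_continuous_on_interval a b y" "abs_continuous_on_interval a b z"
  shows "abs_continuous_on_interval a b (\<lambda>t. y t - z t)"
  unfolding abs_continuous_on_interval_iff
proof (intro allI impI)
  fix e :: real assume "e > 0"
  then have e: "e / 2 > 0" by simp
  obtain d1 where d1: "d1 > 0" and D1: "\<forall>D. short_intervals a b d1 D \<longrightarrow> (\<Sum>(u, v)\<in>D. dist (y u) (y v)) < e / 2"
    using assms(1)[unfolded abs_continuous_on_interval_iff, THEN spec, THEN mp, OF e]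
    by (elim exE conjE) (rule that)
  obtain d2 where d2: "d2 > 0" and D2: "\<forall>D. short_intervals a b d2 D \<longrightarrow> (\<Sum>(u, v)\<in>D. dist (z u) (z v)) < e / 2"
    using assms(2)[unfolded abs_continuous_on_interval_iff, THEN spec, THEN mp, OF e]
    by (elim exE conjE) (rule that)
  show "\<exists>\<delta>>0. \<forall>D. short_intervals a b \<delta> D \<longrightarrow> (\<Sum>(u, v)\<in>D. dist (y u - z u) (y v - z v)) < e"
  proof (rule exI[of _ "min d1 d2"], intro conjI allI impI)
    fix E :: "(real \<times> real) set"
    assume *: "short_intervals a b (min d1 d2) E"
    have "dist (y u - z u) (y v - z v) \<le> dist (y u) (y v) + dist (z u) (z v)" for u v
      using norm_triangle_ineq4[of "y u - y v" "z u - z v"] by (simp add: dist_norm algebra_simps)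
    then have "(\<Sum>(u, v)\<in>E. dist (y u - z u) (y v - z v))
        \<le> (\<Sum>(u, v)\<in>E. dist (y u) (y v)) + (\<Sum>(u, v)\<in>E. dist (z u) (z v))"
      unfolding sum.distrib[symmetric] by (intro sum_mono) (simp add: case_prod_unfold)
    also have "\<dots> < e / 2 + e / 2"
      using D1[THEN spec, of E] D2[THEN spec, of E] * unfolding short_intervals_def
      by (intro add_strict_mono) simp_all
    finally show "(\<Sum>(u, v)\<in>E. dist (y u - z u) (y v - z v)) < e" by simp
  qed (use d1 d2 in simp)
qed

lemma lipschitz_imp_abs_continuous:
  assumes lip: "\<And>u v. a \<le> u \<Longrightarrow> u \<le> v \<Longrightarrow> v \<le> b \<Longrightarrow> dist (y u) (y v) \<le> B * (v - u)"
  shows "abs_continuous_on_interval a b y"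
  unfolding abs_continuous_on_interval_iff
proof (intro allI impI)
  fix e :: real assume e: "e > 0"
  define B' where "B' = max B 1"
  have B': "B' > 0" "B \<le> B'" by (auto simp: B'_def)
  show "\<exists>\<delta>>0. \<forall>D. short_intervals a b \<delta> D \<longrightarrow> (\<Sum>(u, v)\<in>D. dist (y u) (y v)) < e"
  proof (rule exI[of _ "e / B'"], intro conjI allI impI)
    fix E :: "(real \<times> real) set"
    assume *: "short_intervals a b (e / B') E"
    have "(\<Sum>(u, v)\<in>E. dist (y u) (y v)) \<le> (\<Sum>(u, v)\<in>E. B' * (v - u))"
    proof (rule sum_mono, clarify)
      fix u v assume "(u, v) \<in> E"
      then have uv: "a \<le> u" "u \<le> v" "v \<le> b" using * unfolding short_intervals_def by auto
      have "dist (y u) (y v) \<le> B * (v - u)" by (rule lip[OF uv])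
      also have "\<dots> \<le> B' * (v - u)" using B' uv by (intro mult_right_mono) auto
      finally show "dist (y u) (y v) \<le> B' * (v - u)" .
    qed
    also have "\<dots> = B' * (\<Sum>(u, v)\<in>E. v - u)" by (simp add: sum_distrib_left case_prod_unfold)
    also have "\<dots> < e" using * B' by (simp add: short_intervals_def field_simps)
    finally show "(\<Sum>(u, v)\<in>E. dist (y u) (y v)) < e" .
  qed (use e B' in simp)
qed

text \<open>A form of Gronwall's lemma that avoids integrals. On a subinterval of length \<open>h\<close> with
  \<open>L * h \<le> 1/2\<close> that starts at a zero, the mean value inequality bounds the maximum of the norm by
  half of itself; finitely many such steps reach any point.\<close>

lemma abs_continuous_zero_if_derivative_le:
  fixes w :: "real \<Rightarrow> 'a::real_normed_vector"
  assumes ac: "abs_continuous_on_interval 0 T w" and w0: "w 0 = 0" and L: "L \<ge> 0"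
    and der: "AE t in lborel. t \<in> {0..T} \<longrightarrow>
      (\<exists>D. (w has_vector_derivative D) (at t) \<and> norm D \<le> L * norm (w t))"
    and t: "t \<in> {0..T}"
  shows "w t = 0"
proof -
  define h where "h = 1 / (2 * (L + 1))"
  have h: "h > 0" "L * h \<le> 1/2" using L by (auto simp: h_def field_simps)
  have step: "\<forall>t\<in>{a..b}. w t = 0"
    if ab: "0 \<le> a" "a \<le> b" "b \<le> T" "b - a \<le> h" and wa: "w a = 0" for a b
  proof -
    have "continuous_on {a..b} (\<lambda>t. norm (w t))"
      by (intro continuous_on_norm abs_continuous_imp_continuous_on
          abs_continuous_on_subinterval[OF ac]) (use ab in auto)
    then obtain s where s: "s \<in> {a..b}" and smax: "\<And>t. t \<in> {a..b} \<Longrightarrow> norm (w t) \<le> norm (w s)"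
      using continuous_attains_sup[of "{a..b}" "\<lambda>t. norm (w t)"] ab by fastforce
    have "norm (w s - w a) \<le> (L * norm (w s)) * (s - a)"
    proof (rule abs_continuous_norm_diff_le)
      show "abs_continuous_on_interval a s w"
        by (rule abs_continuous_on_subinterval[OF ac]) (use ab s in auto)
      show "AE t in lborel. t \<in> {a..s} \<longrightarrow>
          (\<exists>D. (w has_vector_derivative D) (at t) \<and> norm D \<le> L * norm (w s))"
        using der
      proof eventually_elim
        case (elim t)
        show ?case
        proof
          assume t: "t \<in> {a..s}"
          then obtain D where D: "(w has_vector_derivative D) (at t)" "norm D \<le> L * norm (w t)"
            using elim ab s by auto
          have "L * norm (w t) \<le> L * norm (w s)"
            using smax[of t] t s L by (intro mult_left_mono) auto
          with D show "\<exists>D. (w has_vector_derivative D) (at t) \<and> norm D \<le> L * norm (w s)"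
            by (meson order_trans)
        qed
      qed
    qed (use s L in auto)
    also have "\<dots> \<le> (L * norm (w s)) * h" using s ab L by (intro mult_left_mono) auto
    also have "\<dots> = (L * h) * norm (w s)" by simp
    also have "\<dots> \<le> 1/2 * norm (w s)" using h by (intro mult_right_mono) auto
    finally have "norm (w s) = 0" using wa by simp
    with smax show ?thesis by simp
  qed
  have "\<forall>t\<in>{0..T}. t \<le> real n * h \<longrightarrow> w t = 0" for n
  proof (induction n)
    case 0
    then show ?case using w0 by auto
  next
    case (Suc n)
    show ?case
    proof (intro ballI impI)
      fix t assume t: "t \<in> {0..T}" "t \<le> real (Suc n) * h"
      show "w t = 0"
      proof (cases "t \<le> real n * h")
        case True
        then show ?thesis using Suc t by blast
      next
        case False
        then have "w (real n * h) = 0" using Suc t h by auto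
        then show ?thesis
          using step[of "real n * h" t] t False h by (auto simp: algebra_simps)
      qed
    qed
  qed
  moreover obtain n where "t / h < real n" using reals_Archimedean2 by blast
  then have "t \<le> real n * h" using h by (simp add: field_simps)
  ultimately show ?thesis using t by blast
qed

lemma abs_continuous_cong:
  assumes ac: "abs_continuous_on_interval a b y" and eq: "\<And>t. t \<in> {a..b} \<Longrightarrow> y t = z t"
  shows "abs_continuous_on_interval a b z"
  unfolding abs_continuous_on_interval_iff
proof (intro allI impI)
  fix e :: real assume e: "e > 0"
  obtain \<delta> where d: "\<delta> > 0" and D: "\<forall>D. short_intervals a b \<delta> D \<longrightarrow> (\<Sum>(u, v)\<in>D. dist (y u) (y v)) < e"
    using ac[unfolded abs_continuous_on_interval_iff, THEN spec, THEN mp, OF e]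
    by (elim exE conjE) (rule that)
  show "\<exists>\<delta>>0. \<forall>D. short_intervals a b \<delta> D \<longrightarrow> (\<Sum>(u, v)\<in>D. dist (z u) (z v)) < e"
  proof (rule exI[of _ \<delta>], intro conjI allI impI)
    fix E :: "(real \<times> real) set"
    assume *: "short_intervals a b \<delta> E"
    then have "(\<Sum>(u, v)\<in>E. dist (y u) (y v)) < e" using D[THEN spec, of E] by blast
    also have "(\<Sum>(u, v)\<in>E. dist (y u) (y v)) = (\<Sum>(u, v)\<in>E. dist (z u) (z v))"
    proof (rule sum.cong[OF refl], clarify)
      fix u v assume "(u, v) \<in> E"
      then have "a \<le> u \<and> u \<le> v \<and> v \<le> b" using * unfolding short_intervals_def by blast
      then show "dist (y u) (y v) = dist (z u) (z v)" using eq[of u] eq[of v] by simp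
    qed
    finally show "(\<Sum>(u, v)\<in>E. dist (z u) (z v)) < e" .
  qed (fact d)
qed

section \<open>Existence and uniqueness of solutions\<close>

text \<open>The ranges of two solutions over a bounded interval are compact, so the finitely many modes have a
  common Lipschitz constant there.\<close>

lemma caratheodory_unique:
  fixes f :: "nat \<Rightarrow> 'a::euclidean_space \<Rightarrow> 'a"
  assumes P: "finite P" "\<And>t. t \<ge> 0 \<Longrightarrow> s t \<in> P"
    and lip: "\<And>p. p \<in> P \<Longrightarrow> local_lipschitz (UNIV :: real set) UNIV (\<lambda>_. f p)"
    and y: "abs_continuous_on_interval 0 T y"
      "AE t in lborel. t \<in> {0..T} \<longrightarrow> (y has_vector_derivative f (s t) (y t)) (at t)"
    and z: "abs_continuous_on_interval 0 T z"
      "AE t in lborel. t \<in> {0..T} \<longrightarrow> (z has_vector_derivative f (s t) (z t)) (at t)"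
    and yz: "y 0 = z 0" and t: "t \<in> {0..T}"
  shows "y t = z t"
proof -
  define K where "K = y ` {0..T} \<union> z ` {0..T}"
  have K: "compact K"
    unfolding K_def using y(1) z(1)
    by (intro compact_Un compact_continuous_image abs_continuous_imp_continuous_on) auto
  have "\<exists>L. L-lipschitz_on K (f p)" if p: "p \<in> P" for p
  proof -
    obtain L where "\<And>t. t \<in> {0::real} \<Longrightarrow> L-lipschitz_on K (f p)"
      using local_lipschitz_compact_implies_lipschitz[where X = K and T = "{0::real}" and f = "\<lambda>_. f p"]
        K local_lipschitz_subset[OF lip[OF p], of "{0}" K] by auto
    then show ?thesis by blast
  qed
  then obtain L where L: "\<And>p. p \<in> P \<Longrightarrow> (L p)-lipschitz_on K (f p)" by metis
  define M where "M = (\<Sum>p\<in>P. L p)"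
  have Lnn: "0 \<le> L p" if "p \<in> P" for p using L[OF that] by (rule lipschitz_on_nonneg)
  have LM: "L p \<le> M" if "p \<in> P" for p
    unfolding M_def using member_le_sum[OF that, of L] Lnn P by auto
  have "y t - z t = 0"
  proof (rule abs_continuous_zero_if_derivative_le[OF abs_continuous_diff[OF y(1) z(1)] _ _ _ t])
    show "M \<ge> 0" unfolding M_def using Lnn by (simp add: sum_nonneg)
    show "AE t in lborel. t \<in> {0..T} \<longrightarrow>
      (\<exists>D. ((\<lambda>t. y t - z t) has_vector_derivative D) (at t) \<and> norm D \<le> M * norm (y t - z t))"
      using y(2) z(2)
    proof eventually_elim
      case (elim t)
      show ?case
      proof
        assume t: "t \<in> {0..T}"
        then have p: "s t \<in> P" using P by auto
        have "norm (f (s t) (y t) - f (s t) (z t)) \<le> L (s t) * norm (y t - z t)"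
          using lipschitz_onD[OF L[OF p], of "y t" "z t"] t by (auto simp: K_def dist_norm)
        also have "\<dots> \<le> M * norm (y t - z t)" using LM[OF p] by (intro mult_right_mono) auto
        finally show "\<exists>D. ((\<lambda>t. y t - z t) has_vector_derivative D) (at t)
            \<and> norm D \<le> M * norm (y t - z t)"
          using elim t by (intro exI[of _ "f (s t) (y t) - f (s t) (z t)"])
            (auto intro!: derivative_eq_intros)
      qed
    qed
  qed (use yz in simp)
  then show ?thesis by simp
qed

text \<open>The unknown is \<open>y t = exp (- C * t) *\<^sub>R x t\<close>. For bounded \<open>F\<close> it is a bounded function, and in the
  supremum norm of \<open>y\<close> the Picard operator has Lipschitz constant \<open>L / C \<le> 1/2\<close>, so that Banach's fixed
  point theorem gives the solution for all times at once.\<close>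

lemma bounded_lipschitz_ivp:
  fixes F :: "real \<Rightarrow> 'a::euclidean_space \<Rightarrow> 'a"
  assumes meas: "\<And>y. continuous_on UNIV y \<Longrightarrow> (\<lambda>s. F s (y s)) \<in> borel_measurable borel"
    and lip: "\<And>s x y. norm (F s x - F s y) \<le> L * norm (x - y)" and L: "L \<ge> 0"
    and bnd: "\<And>s x. norm (F s x) \<le> B"
  obtains x where "x 0 = x0" "continuous_on UNIV x"
    "\<And>u v. 0 \<le> u \<Longrightarrow> u \<le> v \<Longrightarrow> dist (x u) (x v) \<le> B * (v - u)"
    "\<And>t. 0 < t \<Longrightarrow> isCont (\<lambda>s. F s (x s)) t \<Longrightarrow> (x has_vector_derivative F t (x t)) (at t)"
proof -
  have B: "B \<ge> 0" using bnd[of 0 0] norm_ge_zero order_trans by blast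
  define C where "C = 2 * max L 1"
  have C: "C > 0" "2 * L \<le> C" by (auto simp: C_def)
  define I where "I y t = integral {0..t} (\<lambda>s. F s (y s))" for y and t :: real
  have int: "(\<lambda>s. F s (y s)) integrable_on {a..b}" if "continuous_on UNIV y" for y and a b :: real
  proof (rule measurable_bounded_by_integrable_imp_integrable)
    show "(\<lambda>s. F s (y s)) \<in> borel_measurable (lebesgue_on {a..b})"
      using meas[OF that] by (intro measurable_restrict_space1 measurable_completion) simp
    show "(\<lambda>_. B) integrable_on {a..b}" by (rule integrable_const_ivl)
  qed (use bnd in auto)
  have Ilip: "norm (I y v - I y u) \<le> B * (v - u)"
    if y: "continuous_on UNIV y" and uv: "0 \<le> u" "u \<le> v" for y u v
  proof -
    have "I y v - I y u = integral {u..v} (\<lambda>s. F s (y s))"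
      unfolding I_def
      using Henstock_Kurzweil_Integration.integral_combine[OF uv int[OF y]] by (simp add: algebra_simps)
    also have "norm \<dots> \<le> integral {u..v} (\<lambda>_. B)"
      by (rule integral_norm_bound_integral[OF int[OF y]]) (use bnd in auto)
    also have "\<dots> = B * (v - u)" using uv by simp
    finally show ?thesis .
  qed
  have Icont: "continuous_on UNIV (\<lambda>t. I y (max 0 t))" if y: "continuous_on UNIV y" for y
  proof (rule lipschitz_on_continuous_on, rule lipschitz_onI)
    fix u v :: real
    show "dist (I y (max 0 u)) (I y (max 0 v)) \<le> B * dist u v"
    proof (induction u v rule: linorder_wlog)
      case (le u v)
      have "dist (I y (max 0 u)) (I y (max 0 v)) \<le> B * (max 0 v - max 0 u)"
        using Ilip[OF y, of "max 0 u" "max 0 v"] le by (auto simp: dist_norm norm_minus_commute)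
      also have "\<dots> \<le> B * dist u v"
        using B le by (intro mult_left_mono) (auto simp: dist_real_def)
      finally show ?case .
    qed (simp add: dist_commute)
  qed (fact B)
  define E where "E y = (\<lambda>s. exp (C * s) *\<^sub>R y s)" for y :: "real \<Rightarrow> 'a"
  have Econt: "continuous_on UNIV (E y)" if "continuous_on UNIV y" for y
    unfolding E_def using that by (intro continuous_intros)
  define G where "G y = (\<lambda>t. exp (- C * max 0 t) *\<^sub>R (x0 + I (E y) (max 0 t)))"
    for y :: "real \<Rightarrow> 'a"
  have G: "G y \<in> bcontfun" if y: "continuous_on UNIV y" for y
  proof -
    have "norm (G y t) \<le> norm x0 + B / C" for t
    proof -
      define r where "r = max 0 t"
      have r: "r \<ge> 0" by (simp add: r_def)
      have "norm (I (E y) r) \<le> B * r"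
        using Ilip[OF Econt[OF y], of 0 r] r by (simp add: I_def)
      then have "norm (x0 + I (E y) r) \<le> norm x0 + B * r"
        by (meson add_left_mono norm_triangle_le)
      then have "norm (G y t) \<le> exp (- C * r) * (norm x0 + B * r)"
        unfolding G_def r_def[symmetric] by simp
      also have "\<dots> = exp (- C * r) * norm x0 + (B / C) * (exp (- C * r) * (C * r))"
        using C by (simp add: field_simps)
      also have "\<dots> \<le> 1 * norm x0 + (B / C) * 1"
      proof (intro add_mono mult_right_mono mult_left_mono)
        have "C * r \<le> exp (C * r)" using exp_ge_add_one_self[of "C * r"] by linarith
        then show "exp (- C * r) * (C * r) \<le> 1" by (simp add: exp_minus field_simps)
      qed (use C r B in auto)
      finally show ?thesis by simp
    qed
    moreover have "continuous_on UNIV (G y)"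
      unfolding G_def using Icont[OF Econt[OF y]] by (intro continuous_intros)
    ultimately show ?thesis unfolding bcontfun_def bounded_iff by blast
  qed
  define \<Phi> where "\<Phi> y = Bcontfun (G (apply_bcontfun y))" for y
  have \<Phi>: "apply_bcontfun (\<Phi> y) = G (apply_bcontfun y)" for y
    unfolding \<Phi>_def using G[of "apply_bcontfun y"] by (simp add: Bcontfun_inverse)
  \<comment> \<open>The exponential weight turns the Picard operator into a contraction on the whole half-line.\<close>
  have "dist (\<Phi> y) (\<Phi> z) \<le> 1/2 * dist y z" for y z
  proof (rule dist_bound)
    fix t :: real
    define r where "r = max 0 t"
    have r: "r \<ge> 0" by (simp add: r_def)
    define m where "m = dist y z"
    have cy: "continuous_on UNIV (E (apply_bcontfun y))" "continuous_on UNIV (E (apply_bcontfun z))"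
      by (auto intro!: Econt)
    have hi: "((\<lambda>s. exp (C * s)) has_integral (exp (C * r) / C - exp (C * 0) / C)) {0..r}"
      using C r by (intro fundamental_theorem_of_calculus)
        (auto intro!: derivative_eq_intros simp: has_real_derivative_iff_has_vector_derivative[symmetric])
    then have hi': "((\<lambda>s. L * m * exp (C * s)) has_integral L * m * (exp (C * r) / C - exp (C * 0) / C)) {0..r}"
      by (rule has_integral_mult_right)
    have Lm: "L * m \<ge> 0" using L by (simp add: m_def)
    have "norm (I (E y) r - I (E z) r)
        = norm (integral {0..r} (\<lambda>s. F s (E y s) - F s (E z s)))"
      unfolding I_def by (subst Henstock_Kurzweil_Integration.integral_diff[OF int int]) (use cy in auto)
    also have "\<dots> \<le> integral {0..r} (\<lambda>s. L * m * exp (C * s))"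
    proof (rule integral_norm_bound_integral)
      show "(\<lambda>s. F s (E y s) - F s (E z s)) integrable_on {0..r}"
        using cy by (intro integrable_diff int)
      show "(\<lambda>s. L * m * exp (C * s)) integrable_on {0..r}" using hi' by blast
      fix s assume "s \<in> {0..r}"
      have "norm (F s (E y s) - F s (E z s)) \<le> L * norm (E y s - E z s)" by (rule lip)
      also have "E y s - E z s = exp (C * s) *\<^sub>R (y s - z s)" by (simp add: E_def algebra_simps)
      also have "L * norm \<dots> = exp (C * s) * (L * dist (y s) (z s))"
        by (simp add: dist_norm)
      also have "\<dots> \<le> exp (C * s) * (L * m)"
        using L dist_bounded[of y s z] by (auto simp: m_def intro!: mult_left_mono)
      finally show "norm (F s (E y s) - F s (E z s)) \<le> L * m * exp (C * s)" by (simp add: ac_simps)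
    qed
    also have "\<dots> = L * m * (exp (C * r) / C - exp (C * 0) / C)" using hi' by (rule integral_unique)
    also have "\<dots> \<le> L * m * (exp (C * r) / C)"
      using Lm C by (intro mult_left_mono) auto
    finally have *: "norm (I (E y) r - I (E z) r) \<le> L * m * (exp (C * r) / C)" .
    have "dist (\<Phi> y t) (\<Phi> z t) = exp (- C * r) * norm (I (E y) r - I (E z) r)"
      unfolding \<Phi> G_def r_def[symmetric] dist_norm scaleR_diff_right[symmetric] by simp
    also have "\<dots> \<le> exp (- C * r) * (L * m * (exp (C * r) / C))"
      using * by (intro mult_left_mono) auto
    also have "\<dots> = (L / C) * m" by (simp add: exp_minus field_simps)
    also have "\<dots> \<le> 1/2 * m" using C by (intro mult_right_mono) (auto simp: m_def field_simps)
    finally show "dist (\<Phi> y t) (\<Phi> z t) \<le> 1/2 * dist y z" unfolding m_def .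
  qed
  then obtain y where y: "\<Phi> y = y"
    using banach_fix_type[of "1/2" \<Phi>] by auto
  define x where "x = E (apply_bcontfun y)"
  have xc: "continuous_on UNIV x" unfolding x_def by (intro Econt) simp
  have xI: "x t = x0 + I x t" if "t \<ge> 0" for t
  proof -
    have "x t = exp (C * t) *\<^sub>R apply_bcontfun (\<Phi> y) t" by (simp add: y x_def E_def)
    also have "\<dots> = x0 + I x t" using that by (simp add: \<Phi> G_def x_def exp_minus)
    finally show ?thesis .
  qed
  show thesis
  proof (rule that)
    show "x 0 = x0" using xI[of 0] by (simp add: I_def)
    show "continuous_on UNIV x" by fact
    show "dist (x u) (x v) \<le> B * (v - u)" if "0 \<le> u" "u \<le> v" for u v
      using Ilip[OF xc that] that xI[of u] xI[of v] by (simp add: dist_norm norm_minus_commute)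
    show "(x has_vector_derivative F t (x t)) (at t)"
      if t: "0 < t" and cont: "isCont (\<lambda>s. F s (x s)) t" for t
    proof -
      have "((\<lambda>u. integral {0..u} (\<lambda>s. F s (x s))) has_vector_derivative F t (x t))
          (at t within ({0..t + 1} - {}))"
        by (rule integral_has_vector_derivative_continuous_at[OF int[OF xc]])
          (use t cont continuous_at_imp_continuous_at_within in auto)
      then have "((\<lambda>u. I x u) has_vector_derivative F t (x t)) (at t within {0<..<t + 1})"
        unfolding I_def by (rule has_vector_derivative_within_subset) auto
      then have "((\<lambda>u. I x u) has_vector_derivative F t (x t)) (at t)"
        using t by (subst (asm) has_vector_derivative_within_open) auto
      then have "((\<lambda>u. x0 + I x u) has_vector_derivative F t (x t)) (at t)"
        by (auto intro!: derivative_eq_intros)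
      then show ?thesis
        by (rule has_vector_derivative_transform_within_open[where S="{0<..}"]) (use t xI in auto)
    qed
  qed
qed

section \<open>Step signals\<close>

text \<open>The path property that follows from right continuity and left limits for a process with values
  in a discrete space. The left-hand condition is restricted to nonnegative times because the values
  of a signal at negative times are arbitrary.\<close>

definition step_signal :: "(real \<Rightarrow> nat) \<Rightarrow> bool" where
  "step_signal s \<longleftrightarrow> (\<forall>t\<ge>0. \<exists>d>0. (\<forall>u. t \<le> u \<and> u < t + d \<longrightarrow> s u = s t) \<and>
     (\<exists>l. \<forall>u. 0 \<le> u \<and> t - d < u \<and> u < t \<longrightarrow> s u = l))"

lemma cadlag_process_imp_step_signal:
  assumes c: "cadlag_process M N \<sigma>" and w: "\<omega> \<in> space M"
  shows "step_signal (\<lambda>t. \<sigma> t \<omega>)"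
  unfolding step_signal_def
proof (intro allI impI)
  fix t :: real assume t: "t \<ge> 0"
  have "continuous (at_right t) (\<lambda>s. \<sigma> s \<omega>)" using c w t unfolding cadlag_process_def by blast
  then have "((\<lambda>s. \<sigma> s \<omega>) \<longlongrightarrow> \<sigma> t \<omega>) (at_right t)" by (simp add: continuous_within)
  then have "eventually (\<lambda>s. \<sigma> s \<omega> = \<sigma> t \<omega>) (at_right t)" by (simp add: nhds_discrete filterlim_principal)
  then obtain b where b: "b > t" "\<And>u. t < u \<Longrightarrow> u < b \<Longrightarrow> \<sigma> u \<omega> = \<sigma> t \<omega>"
    by (auto simp: eventually_at_right_field)
  have "\<exists>e>0. \<exists>l. \<forall>u. 0 \<le> u \<and> t - e < u \<and> u < t \<longrightarrow> \<sigma> u \<omega> = l"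
  proof (cases "t = 0")
    case True
    then show ?thesis by (intro exI[of _ 1]) auto
  next
    case False
    then obtain l where "((\<lambda>s. \<sigma> s \<omega>) \<longlongrightarrow> l) (at_left t)"
      using c w t unfolding cadlag_process_def by force
    then have "eventually (\<lambda>s. \<sigma> s \<omega> = l) (at_left t)" by (simp add: nhds_discrete filterlim_principal)
    then obtain a where "a < t" "\<And>u. a < u \<Longrightarrow> u < t \<Longrightarrow> \<sigma> u \<omega> = l"
      by (auto simp: eventually_at_left_field)
    then show ?thesis by (intro exI[of _ "t - a"]) auto
  qed
  then obtain e l where e: "e > 0" "\<And>u. 0 \<le> u \<Longrightarrow> t - e < u \<Longrightarrow> u < t \<Longrightarrow> \<sigma> u \<omega> = l" by blast
  show "\<exists>d>0. (\<forall>u. t \<le> u \<and> u < t + d \<longrightarrow> \<sigma> u \<omega> = \<sigma> t \<omega>) \<and>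
     (\<exists>l. \<forall>u. 0 \<le> u \<and> t - d < u \<and> u < t \<longrightarrow> \<sigma> u \<omega> = l)"
  proof (rule exI[of _ "min e (b - t)"], intro conjI allI impI exI[of _ l])
    show "\<sigma> u \<omega> = \<sigma> t \<omega>" if "t \<le> u \<and> u < t + min e (b - t)" for u
      using b(2)[of u] that by (cases "u = t") auto
  qed (use b e in auto)
qed

text \<open>Constant extension of a signal to negative times makes the neighbourhoods of a step signal open
  intervals, so that topological covering arguments on the real line apply.\<close>

definition switch_radius :: "(real \<Rightarrow> nat) \<Rightarrow> real \<Rightarrow> real \<Rightarrow> bool" where
  "switch_radius s t d \<longleftrightarrow> d > 0 \<and>
     (\<forall>u. t \<le> u \<longrightarrow> u < t + d \<longrightarrow> s (max 0 u) = s (max 0 t)) \<and>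
     (\<exists>l. \<forall>u. t - d < u \<longrightarrow> u < t \<longrightarrow> s (max 0 u) = l)"

lemma switch_radiusD:
  assumes "switch_radius s t d"
  shows "d > 0" "t \<le> u \<Longrightarrow> u < t + d \<Longrightarrow> s (max 0 u) = s (max 0 t)"
    "t - d < u \<Longrightarrow> u < t \<Longrightarrow> t - d < u' \<Longrightarrow> u' < t \<Longrightarrow> s (max 0 u) = s (max 0 u')"
  using assms unfolding switch_radius_def by (blast, blast, metis)

lemma ex_switch_radius:
  assumes "step_signal s"
  shows "\<exists>d. switch_radius s t d"
proof (cases "t > 0")
  case True
  then have t0: "t \<ge> 0" by simp
  obtain d where d1: "d > 0" "\<forall>u. t \<le> u \<and> u < t + d \<longrightarrow> s u = s t"
    and "\<exists>l. \<forall>u. 0 \<le> u \<and> t - d < u \<and> u < t \<longrightarrow> s u = l"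
    using assms[unfolded step_signal_def, THEN spec, THEN mp, OF t0]
    by (elim exE conjE) (rule that, assumption+, rule exI)
  then obtain l where d2: "\<forall>u. 0 \<le> u \<and> t - d < u \<and> u < t \<longrightarrow> s u = l"
    by (elim exE) (rule that)
  have "switch_radius s t (min d t)"
    unfolding switch_radius_def
  proof (intro conjI exI[of _ l] allI impI)
    show "s (max 0 u) = s (max 0 t)" if "t \<le> u" "u < t + min d t" for u
      using d1(2)[THEN spec, of u] that True by simp
    show "s (max 0 u) = l" if "t - min d t < u" "u < t" for u
      using d2[THEN spec, of u] that True by (auto simp: min_def split: if_splits)
  qed (use d1(1) True in simp)
  then show ?thesis ..
next
  case False
  obtain d where d: "d > 0" "\<forall>u. 0 \<le> u \<and> u < 0 + d \<longrightarrow> s u = s 0"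
    using assms[unfolded step_signal_def, THEN spec, THEN mp, OF order_refl]
    by (elim exE conjE) (rule that)
  have "switch_radius s t (if t = 0 then d else - t)"
    unfolding switch_radius_def
  proof (intro conjI exI[of _ "s 0"] allI impI)
    show "s (max 0 u) = s (max 0 t)" if "t \<le> u" "u < t + (if t = 0 then d else - t)" for u
      using d(2)[THEN spec, of u] that False by (auto split: if_splits)
  qed (use d(1) False in auto)
  then show ?thesis ..
qed

text \<open>These are the discontinuities of the signal after constant extension to negative times.\<close>

definition jump_times :: "(real \<Rightarrow> nat) \<Rightarrow> real set" where
  "jump_times s = {t. \<not> (\<forall>\<^sub>F u in nhds t. s (max 0 u) = s (max 0 t))}"

text \<open>A neighbourhood of radius \<open>d t\<close> contains no jump except possibly \<open>t\<close> itself. By Lindelof's theorem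
  countably many such neighbourhoods cover the line.\<close>

lemma countable_jump_times:
  assumes "step_signal s"
  shows "countable (jump_times s)"
proof -
  obtain d where "\<forall>t. switch_radius s t (d t)"
    using ex_switch_radius[OF assms] by metis
  then have d: "switch_radius s t (d t)" for t by blast
  have no_jump: "u \<notin> jump_times s" if u: "u \<in> ball t (d t)" "u \<noteq> t" for t u
  proof -
    have "\<forall>\<^sub>F u' in nhds u. s (max 0 u') = s (max 0 u)"
    proof (cases "u < t")
      case True
      have "s (max 0 u') = s (max 0 u)" if "u' \<in> {t - d t<..<t}" for u'
        by (intro switch_radiusD(3)[OF d[of t]]) (use u that True in \<open>auto simp: dist_real_def\<close>)
      moreover have "\<forall>\<^sub>F u' in nhds u. u' \<in> {t - d t<..<t}"
        using u True by (intro eventually_nhds_in_open) (auto simp: dist_real_def)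
      ultimately show ?thesis by (rule eventually_mono[rotated])
    next
      case False
      have "s (max 0 u') = s (max 0 u)" if "u' \<in> {t<..<t + d t}" for u'
        using u that False switch_radiusD(2)[OF d[of t], of u] switch_radiusD(2)[OF d[of t], of u']
        by (simp add: dist_real_def)
      moreover have "\<forall>\<^sub>F u' in nhds u. u' \<in> {t<..<t + d t}"
        using u False by (intro eventually_nhds_in_open) (auto simp: dist_real_def)
      ultimately show ?thesis by (rule eventually_mono[rotated])
    qed
    then show ?thesis by (simp add: jump_times_def)
  qed
  obtain \<F> where F: "\<F> \<subseteq> range (\<lambda>t. ball t (d t))" "countable \<F>"
    "\<Union>\<F> = (\<Union>t. ball t (d t))"
    using Lindelof[of "range (\<lambda>t. ball t (d t))"] by auto
  obtain T where T: "countable T" "\<F> = (\<lambda>t. ball t (d t)) ` T"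
    using conjI[OF F(2,1)] unfolding countable_subset_image by blast
  have "jump_times s \<subseteq> T"
  proof
    fix u assume u: "u \<in> jump_times s"
    have "u \<in> ball u (d u)" using switch_radiusD(1)[OF d] by simp
    then have "u \<in> \<Union>\<F>" unfolding F(3) by blast
    then obtain t where "t \<in> T" "u \<in> ball t (d t)" unfolding T(2) by blast
    then show "u \<in> T" using no_jump u by blast
  qed
  then show ?thesis using T(1) countable_subset by blast
qed

lemma isCont_switched:
  assumes t: "t \<notin> jump_times s" and g: "continuous_on UNIV (g (s (max 0 t)))"
    and y: "continuous_on UNIV y"
  shows "isCont (\<lambda>u. g (s (max 0 u)) (y u)) t"
proof -
  have "\<forall>\<^sub>F u in nhds t. g (s (max 0 u)) (y u) = g (s (max 0 t)) (y u)"
    using t unfolding jump_times_def mem_Collect_eq not_not by (rule eventually_mono) simp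
  moreover have "isCont (\<lambda>u. g (s (max 0 t)) (y u)) t"
    using continuous_on_compose2[OF g y] by (simp add: continuous_on_eq_continuous_at)
  ultimately show ?thesis using isCont_cong by fastforce
qed

text \<open>At most one switch happens in the interval, and the new state is already taken at the time \<open>\<tau>\<close> of
  the switch. The case of no switch is covered by \<open>\<tau> = a\<close>.\<close>

definition one_switch :: "(real \<Rightarrow> nat) \<Rightarrow> real \<Rightarrow> real \<Rightarrow> bool" where
  "one_switch s a b \<longleftrightarrow>
     (\<exists>\<tau>\<in>{a..b}. (\<forall>u\<in>{a..<\<tau>}. s u = s a) \<and> (\<forall>u\<in>{\<tau>..b}. s u = s b))"

text \<open>The neighbourhoods from \<open>ex_switch_radius\<close> cover the compact interval, and an interval shorter
  than a Lebesgue number of this cover lies inside one of them.\<close>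

lemma step_signal_short_intervals:
  assumes s: "step_signal s"
  obtains \<delta> where "\<delta> > 0"
    "\<And>a b. 0 \<le> a \<Longrightarrow> a \<le> b \<Longrightarrow> b \<le> T \<Longrightarrow> b - a < \<delta> \<Longrightarrow> one_switch s a b"
proof -
  obtain d where "\<forall>t. switch_radius s t (d t)"
    using ex_switch_radius[OF s] by metis
  then have d: "switch_radius s t (d t)" for t by blast
  obtain \<delta> where \<delta>: "\<delta> > 0" and leb: "\<And>A. A \<subseteq> {0..T} \<Longrightarrow> diameter A < \<delta> \<Longrightarrow>
      \<exists>B\<in>range (\<lambda>t. ball t (d t)). A \<subseteq> B"
  proof (rule Lebesgue_number_lemma[of "{0..T}" "range (\<lambda>t. ball t (d t))"])
    show "{0..T} \<subseteq> \<Union> (range (\<lambda>t. ball t (d t)))"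
    proof
      fix x
      have "x \<in> ball x (d x)" using switch_radiusD(1)[OF d] by simp
      then show "x \<in> \<Union> (range (\<lambda>t. ball t (d t)))" by blast
    qed
  qed auto
  show thesis
  proof (rule that[OF \<delta>])
    fix a b :: real assume ab: "0 \<le> a" "a \<le> b" "b \<le> T" "b - a < \<delta>"
    have "diameter {a..b} < \<delta>" using ab by (simp add: diameter_closed_interval)
    then obtain t where t: "{a..b} \<subseteq> ball t (d t)" using leb[of "{a..b}"] ab by auto
    have "a \<in> ball t (d t)" "b \<in> ball t (d t)" using t ab atLeastAtMost_iff by blast+
    then have ab': "t - d t < a" "b < t + d t" by (auto simp: dist_real_def)
    have right: "s u = s (max 0 t)" if "t \<le> u" "u < t + d t" "0 \<le> u" for u
      using switch_radiusD(2)[OF d[of t] that(1,2)] that by simp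
    have left: "s u = s u'" if "t - d t < u" "u < t" "t - d t < u'" "u' < t" "0 \<le> u" "0 \<le> u'" for u u'
      using switch_radiusD(3)[OF d[of t] that(1-4)] that by simp
    consider "t \<le> a" | "b < t" | "a < t" "t \<le> b" by linarith
    then show "one_switch s a b"
    proof cases
      case 1
      have *: "s u = s b" if "u \<in> {a..b}" for u
        using right[of u] right[of b] 1 that ab ab' by simp
      show ?thesis unfolding one_switch_def
        by (intro bexI[of _ a] conjI ballI) (simp, rule *, use ab in simp_all)
    next
      case 2
      have *: "s u = s b" if "u \<in> {a..b}" for u
        by (rule left) (use 2 that ab ab' in auto)
      show ?thesis unfolding one_switch_def
        by (intro bexI[of _ a] conjI ballI) (simp, rule *, use ab in simp_all)
    next
      case 3
      have *: "s u = s b" if "u \<in> {t..b}" for u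
        using right[of u] right[of b] 3 that ab ab' by simp
      have **: "s u = s a" if "u \<in> {a..<t}" for u
        by (rule left) (use 3 that ab ab' in auto)
      show ?thesis unfolding one_switch_def
        by (intro bexI[of _ t] conjI ballI) (rule **, assumption, rule *, assumption, use 3 in simp)
    qed
  qed
qed

lemma not_jump_time_interior:
  assumes s: "\<And>u. u \<in> {a..<b} \<Longrightarrow> s u = p" and a: "0 \<le> a" and t: "t \<in> {a<..<b}"
  shows "t \<notin> jump_times s"
proof -
  have "\<forall>\<^sub>F u in nhds t. u \<in> {a<..<b}" using t by (intro eventually_nhds_in_open) auto
  then have "\<forall>\<^sub>F u in nhds t. s (max 0 u) = s (max 0 t)"
  proof (rule eventually_mono)
    fix u assume "u \<in> {a<..<b}"
    then show "s (max 0 u) = s (max 0 t)" using s[of u] s[of t] t a by simp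
  qed
  then show ?thesis by (simp add: jump_times_def)
qed

lemma AE_off_jump_times:
  assumes "step_signal s" and "\<And>t. t > 0 \<Longrightarrow> t < T \<Longrightarrow> t \<notin> jump_times s \<Longrightarrow> Q t"
  shows "AE t in lborel. t \<in> {0..T} \<longrightarrow> Q t"
proof (rule AE_I')
  show "jump_times s \<union> {0, T} \<in> null_sets lborel"
    by (rule countable_imp_null_set_lborel) (use countable_jump_times[OF assms(1)] in auto)
qed (use assms(2) in force)

section \<open>Decay of Lyapunov functions along a switching signal\<close>

text \<open>A switch is visible on the grid of mesh \<open>1 / 2 ^ n\<close> if the states at the two ends of a cell differ.
  This count depends on finitely many values of the signal, which makes it a random variable of the
  past.\<close>

definition grid_switches :: "(real \<Rightarrow> nat) \<Rightarrow> nat \<Rightarrow> nat \<Rightarrow> nat" where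
  "grid_switches s n m = card {i. i < m \<and> s (real i / 2 ^ n) \<noteq> s (real (Suc i) / 2 ^ n)}"

lemma grid_switches_Suc:
  "grid_switches s n (Suc m) = grid_switches s n m +
     of_bool (s (real m / 2 ^ n) \<noteq> s (real (Suc m) / 2 ^ n))"
proof -
  let ?P = "\<lambda>i. s (real i / 2 ^ n) \<noteq> s (real (Suc i) / 2 ^ n)"
  have "{i. i < Suc m \<and> ?P i} = {i. i < m \<and> ?P i} \<union> (if ?P m then {m} else {})"
    by (auto simp: less_Suc_eq)
  then show ?thesis unfolding grid_switches_def by (auto simp: card_insert_if)
qed

lemma grid_switches_mono: "m \<le> m' \<Longrightarrow> grid_switches s n m \<le> grid_switches s n m'"
  unfolding grid_switches_def by (intro card_mono) auto

lemma grid_switches_0 [simp]: "grid_switches s n 0 = 0"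
  by (simp add: grid_switches_def)

definition fine_grid :: "(real \<Rightarrow> nat) \<Rightarrow> nat \<Rightarrow> nat \<Rightarrow> bool" where
  "fine_grid s T n \<longleftrightarrow>
     (\<forall>a b. 0 \<le> a \<longrightarrow> a \<le> b \<longrightarrow> b \<le> real T \<longrightarrow> b - a \<le> 1 / 2 ^ n \<longrightarrow> one_switch s a b)"

lemma ex_fine_grid:
  assumes s: "step_signal s"
  obtains n0 where "\<And>n. n \<ge> n0 \<Longrightarrow> fine_grid s T n"
proof -
  obtain \<delta> where \<delta>: "\<delta> > 0"
    "\<And>a b. 0 \<le> a \<Longrightarrow> a \<le> b \<Longrightarrow> b \<le> real T \<Longrightarrow> b - a < \<delta> \<Longrightarrow> one_switch s a b"
    using step_signal_short_intervals[OF s] by metis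
  obtain n0 where n0: "1 / 2 ^ n0 < \<delta>"
    using real_arch_pow_inv[of \<delta> "1/2"] \<delta>(1) by (auto simp: power_one_over)
  show thesis
  proof (rule that)
    fix n assume n: "n \<ge> n0"
    have "(1::real) / 2 ^ n \<le> 1 / 2 ^ n0" using n by (intro divide_left_mono power_increasing) auto
    with n0 show "fine_grid s T n" unfolding fine_grid_def using \<delta>(2) by auto
  qed
qed

text \<open>Here \<open>v p t\<close> stands for \<open>V\<^bsub>p\<^esub>(x(t))\<close>. In a cell with at most one switch the state at the left end is
  used up to the switch and the state at the right end after it, and the factor \<open>mu\<close> is paid only if
  they differ. The additional factor \<open>mu\<close> in the conclusion pays for a switch between the last grid
  point before \<open>t\<close> and \<open>t\<close>.\<close>

lemma switched_decay:
  fixes v :: "nat \<Rightarrow> real \<Rightarrow> real"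
  assumes fine: "fine_grid s T n" and sP: "\<And>t. t \<ge> 0 \<Longrightarrow> s t \<in> P" and mu: "mu \<ge> 1"
    and nonneg: "\<And>p t. p \<in> P \<Longrightarrow> t \<ge> 0 \<Longrightarrow> v p t \<ge> 0"
    and comp: "\<And>p p' t. p \<in> P \<Longrightarrow> p' \<in> P \<Longrightarrow> t \<ge> 0 \<Longrightarrow> v p t \<le> mu * v p' t"
    and decay: "\<And>p a b. p \<in> P \<Longrightarrow> 0 \<le> a \<Longrightarrow> a < b \<Longrightarrow> (\<And>u. u \<in> {a..<b} \<Longrightarrow> s u = p) \<Longrightarrow>
      v p b \<le> exp (- c * (b - a)) * v p a"
    and t: "t \<in> {0..real T}"
  shows "v (s t) t \<le> mu ^ Suc (grid_switches s n (T * 2 ^ n)) * exp (- c * t) * v (s 0) 0"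
proof -
  have cell: "v (s b) b \<le> mu ^ of_bool (s a \<noteq> s b) * (exp (- c * (b - a)) * v (s a) a)"
    if one: "one_switch s a b" and ab: "0 \<le> a" "a \<le> b" for a b
  proof -
    obtain \<tau> where \<tau>: "\<tau> \<in> {a..b}"
      and sa: "\<forall>u\<in>{a..<\<tau>}. s u = s a" and sb: "\<forall>u\<in>{\<tau>..b}. s u = s b"
      using one unfolding one_switch_def by (elim bexE conjE) (rule that)
    have le1: "v (s b) b \<le> exp (- c * (b - \<tau>)) * v (s b) \<tau>"
    proof (cases "\<tau> < b")
      case True
      have eq: "s u = s b" if "u \<in> {\<tau>..<b}" for u using sb[THEN bspec, of u] that by simp
      show ?thesis by (rule decay[OF _ _ True eq]) (use \<tau> ab sP in auto)
    qed (use \<tau> in auto)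
    have le2: "v (s a) \<tau> \<le> exp (- c * (\<tau> - a)) * v (s a) a"
    proof (cases "a < \<tau>")
      case True
      show ?thesis
        by (rule decay[OF _ ab(1) True sa[THEN bspec]]) (use sP ab in auto)
    qed (use \<tau> in auto)
    have le3: "v (s b) \<tau> \<le> mu ^ of_bool (s a \<noteq> s b) * v (s a) \<tau>"
      using comp[of "s b" "s a" \<tau>] sP ab \<tau> by auto
    have "v (s b) b \<le> exp (- c * (b - \<tau>)) * (mu ^ of_bool (s a \<noteq> s b) * v (s a) \<tau>)"
      using le1 le3 by (meson exp_ge_zero mult_left_mono order_trans)
    also have "\<dots> \<le> exp (- c * (b - \<tau>)) *
        (mu ^ of_bool (s a \<noteq> s b) * (exp (- c * (\<tau> - a)) * v (s a) a))"
      using le2 mu by (intro mult_left_mono) auto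
    also have "\<dots> = mu ^ of_bool (s a \<noteq> s b) *
        ((exp (- c * (b - \<tau>)) * exp (- c * (\<tau> - a))) * v (s a) a)" by (simp only: ac_simps)
    also have "exp (- c * (b - \<tau>)) * exp (- c * (\<tau> - a)) = exp (- c * (b - a))"
      unfolding exp_add[symmetric] by (simp add: algebra_simps)
    finally show ?thesis .
  qed
  let ?g = "\<lambda>i. real i / 2 ^ n"
  have grid: "v (s (?g m)) (?g m) \<le> mu ^ grid_switches s n m * exp (- c * ?g m) * v (s 0) 0"
    if "m \<le> T * 2 ^ n" for m
    using that
  proof (induction m)
    case 0
    then show ?case by simp
  next
    case (Suc m)
    have "real (Suc m) \<le> real (T * 2 ^ n)" using Suc.prems by (simp only: of_nat_le_iff)
    then have "?g (Suc m) \<le> real T" by (simp add: divide_le_eq)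
    moreover have diff: "?g (Suc m) - ?g m = 1 / 2 ^ n" by (simp add: add_divide_distrib)
    moreover have "?g m \<le> ?g (Suc m)" by (simp add: divide_right_mono)
    ultimately have one: "one_switch s (?g m) (?g (Suc m))"
      using fine unfolding fine_grid_def by auto
    have "v (s (?g (Suc m))) (?g (Suc m))
        \<le> mu ^ of_bool (s (?g m) \<noteq> s (?g (Suc m))) *
          (exp (- c * (?g (Suc m) - ?g m)) * v (s (?g m)) (?g m))"
      by (rule cell[OF one]) (auto simp: divide_right_mono)
    also have "\<dots> \<le> mu ^ of_bool (s (?g m) \<noteq> s (?g (Suc m))) *
          (exp (- c * (?g (Suc m) - ?g m)) *
           (mu ^ grid_switches s n m * exp (- c * ?g m) * v (s 0) 0))"
      using Suc mu by (intro mult_left_mono) auto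
    also have "\<dots> = mu ^ grid_switches s n (Suc m) *
        (exp (- c * (?g (Suc m) - ?g m)) * exp (- c * ?g m)) * v (s 0) 0"
      unfolding grid_switches_Suc power_add by (simp only: ac_simps)
    also have "exp (- c * (?g (Suc m) - ?g m)) * exp (- c * ?g m) = exp (- c * ?g (Suc m))"
      unfolding exp_add[symmetric] by (simp add: algebra_simps)
    finally show ?case .
  qed
  define m where "m = nat \<lfloor>t * 2 ^ n\<rfloor>"
  have m1: "?g m \<le> t"
    using t unfolding m_def by (simp add: divide_le_eq)
  have m2: "t - ?g m < 1 / 2 ^ n"
  proof -
    have "t * 2 ^ n < real m + 1" using t unfolding m_def by simp
    then have "t < (real m + 1) / 2 ^ n" by (simp add: less_divide_eq)
    then show ?thesis by (simp add: add_divide_distrib)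
  qed
  have m3: "m \<le> T * 2 ^ n"
  proof -
    have "?g m \<le> real T" using m1 t by simp
    then have "real m \<le> real (T * 2 ^ n)" by (simp add: divide_le_eq)
    then show ?thesis by (simp only: of_nat_le_iff)
  qed
  have one: "one_switch s (?g m) t" using fine m1 m2 t unfolding fine_grid_def by auto
  have "v (s t) t \<le> mu ^ of_bool (s (?g m) \<noteq> s t) * (exp (- c * (t - ?g m)) * v (s (?g m)) (?g m))"
    by (rule cell[OF one]) (use m1 in auto)
  also have "\<dots> \<le> mu ^ 1 * (exp (- c * (t - ?g m)) * v (s (?g m)) (?g m))"
    using mu nonneg[of "s (?g m)" "?g m"] sP
    by (intro mult_right_mono power_increasing) auto
  also have "\<dots> \<le> mu ^ 1 * (exp (- c * (t - ?g m)) *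
      (mu ^ grid_switches s n m * exp (- c * ?g m) * v (s 0) 0))"
    using grid[OF m3] mu by (intro mult_left_mono) auto
  also have "\<dots> = mu ^ Suc (grid_switches s n m) *
      (exp (- c * (t - ?g m)) * exp (- c * ?g m)) * v (s 0) 0"
    by (simp add: ac_simps)
  also have "exp (- c * (t - ?g m)) * exp (- c * ?g m) = exp (- c * t)"
    unfolding exp_add[symmetric] by (simp add: algebra_simps)
  also have "mu ^ Suc (grid_switches s n m) * exp (- c * t) * v (s 0) 0
      \<le> mu ^ Suc (grid_switches s n (T * 2 ^ n)) * exp (- c * t) * v (s 0) 0"
    using mu nonneg[of "s 0" 0] sP[of 0] grid_switches_mono[OF m3, of s n]
    by (intro mult_right_mono power_increasing) auto
  finally show "v (s t) t \<le> mu ^ Suc (grid_switches s n (T * 2 ^ n)) * exp (- c * t) * v (s 0) 0" .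
qed

lemma lyapunov_decay:
  fixes x :: "real \<Rightarrow> 'a::real_normed_vector" and V :: "'a \<Rightarrow> real"
  assumes V: "\<And>z. (V has_derivative V' z) (at z)"
    and x: "continuous_on {a..b} x" and ab: "a < b"
    and der: "\<And>t. t \<in> {a<..<b} \<Longrightarrow> (x has_vector_derivative D t) (at t)"
    and dec: "\<And>t. t \<in> {a<..<b} \<Longrightarrow> V' (x t) (D t) \<le> - c * V (x t)"
  shows "V (x b) \<le> exp (- c * (b - a)) * V (x a)"
proof -
  define g where "g t = exp (c * t) * V (x t)" for t
  have "g a \<ge> g b"
  proof (rule DERIV_nonpos_imp_decreasing_open[of a b g])
    show "a \<le> b" using ab by simp
    have "continuous_on UNIV V"
      by (intro continuous_at_imp_continuous_on ballI has_derivative_continuous[OF V])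
    then show "continuous_on {a..b} g"
      unfolding g_def using continuous_on_compose2[OF _ x, of UNIV V]
      by (intro continuous_intros) auto
    fix t assume t: "a < t" "t < b"
    then have xt: "(x has_vector_derivative D t) (at t)" using der by auto
    have "((V \<circ> x) has_vector_derivative V' (x t) (D t)) (at t)"
      by (rule vector_derivative_diff_chain_within[OF xt has_derivative_at_withinI[OF V]])
    then have "((\<lambda>t. V (x t)) has_real_derivative V' (x t) (D t)) (at t)"
      by (simp add: o_def has_real_derivative_iff_has_vector_derivative)
    then have "(g has_real_derivative exp (c * t) * (V' (x t) (D t) + c * V (x t))) (at t)"
      unfolding g_def by (auto intro!: derivative_eq_intros simp: algebra_simps)
    moreover have "exp (c * t) * (V' (x t) (D t) + c * V (x t)) \<le> 0"
      using dec[of t] t by (intro mult_nonneg_nonpos) auto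
    ultimately show "\<exists>y. (g has_real_derivative y) (at t) \<and> y \<le> 0" by blast
  qed
  then have "exp (- c * b) * (exp (c * b) * V (x b)) \<le> exp (- c * b) * (exp (c * a) * V (x a))"
    unfolding g_def by (intro mult_left_mono) auto
  then show ?thesis
    unfolding mult.assoc[symmetric] exp_add[symmetric] by (simp add: algebra_simps)
qed

section \<open>The number of switches of a Markov chain\<close>

text \<open>The sigma algebra of the past as a measure, so that measurability of functions can be expressed.\<close>

definition past_algebra :: "'w measure \<Rightarrow> (real \<Rightarrow> 'w \<Rightarrow> nat) \<Rightarrow> real \<Rightarrow> 'w measure" where
  "past_algebra M \<sigma> t = sigma (space M) (past_events M \<sigma> t)"

lemma past_events_algebra: "sigma_algebra (space M) (past_events M \<sigma> t)"
  unfolding past_events_def by (rule sigma_algebra_sigma_sets) auto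

lemma space_past_algebra [simp]: "space (past_algebra M \<sigma> t) = space M"
  and sets_past_algebra: "sets (past_algebra M \<sigma> t) = past_events M \<sigma> t"
  unfolding past_algebra_def
  using past_events_algebra[of M \<sigma> t]
  by (simp_all add: space_measure_of_conv sigma_algebra.sets_measure_of_eq)

lemma cadlag_process_measurable:
  assumes "cadlag_process M N \<sigma>" "u \<ge> 0"
  shows "\<sigma> u \<in> measurable M (count_space UNIV)"
  using assms measurable_compose[of "\<sigma> u" M "count_space {1..N}" "\<lambda>x. x" "count_space UNIV"]
  unfolding cadlag_process_def by auto

lemma past_events_subset_sets:
  assumes "cadlag_process M N \<sigma>"
  shows "past_events M \<sigma> t \<subseteq> sets M"
  unfolding past_events_def
proof (rule sets.sigma_sets_subset, safe)
  fix s :: real and B assume "0 \<le> s"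
  then have m: "\<sigma> s \<in> measurable M (count_space {1..N})"
    using assms unfolding cadlag_process_def by blast
  have "\<sigma> s -` B \<inter> space M = \<sigma> s -` (B \<inter> {1..N}) \<inter> space M"
    using measurable_space[OF m] by auto
  also have "\<dots> \<in> sets M" by (rule measurable_sets[OF m]) auto
  finally show "\<sigma> s -` B \<inter> space M \<in> sets M" .
qed

lemma measurable_past:
  assumes "0 \<le> s" "s \<le> t"
  shows "\<sigma> s \<in> measurable (past_algebra M \<sigma> t) (count_space UNIV)"
proof (rule measurableI)
  fix B :: "nat set"
  show "\<sigma> s -` B \<inter> space (past_algebra M \<sigma> t) \<in> sets (past_algebra M \<sigma> t)"
    unfolding sets_past_algebra space_past_algebra past_events_def
    using assms by (intro sigma_sets.Basic) auto
qed simp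

text \<open>The grid count up to time \<open>t\<close> reads only values of the process up to \<open>t\<close>. Therefore its level sets
  are admissible conditioning events in the Markov property.\<close>

lemma grid_switches_measurable_past:
  assumes "real m / 2 ^ n \<le> t"
  shows "(\<lambda>\<omega>. grid_switches (\<lambda>t. \<sigma> t \<omega>) n m)
    \<in> measurable (past_algebra M \<sigma> t) (count_space UNIV)"
  using assms
proof (induction m)
  case 0
  then show ?case by simp
next
  case (Suc m)
  have le: "real m / 2 ^ n \<le> real (Suc m) / 2 ^ n" by (simp add: divide_right_mono)
  have [measurable]: "(\<lambda>\<omega>. grid_switches (\<lambda>t. \<sigma> t \<omega>) n m)
    \<in> measurable (past_algebra M \<sigma> t) (count_space UNIV)"
    using Suc le by simp
  have [measurable]: "\<sigma> (real m / 2 ^ n)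
    \<in> measurable (past_algebra M \<sigma> t) (count_space UNIV)"
    using Suc.prems le by (intro measurable_past) auto
  have [measurable]: "\<sigma> (real (Suc m) / 2 ^ n)
    \<in> measurable (past_algebra M \<sigma> t) (count_space UNIV)"
    using Suc.prems by (intro measurable_past) auto
  show ?case unfolding grid_switches_Suc of_bool_def by measurable
qed

lemma grid_switches_le: "grid_switches s n m \<le> m"
  by (induction m) (auto simp: grid_switches_Suc)

text \<open>The infinitesimal condition holds at each time separately, with an error term that depends on the
  time. Homogeneity transports it from one time at which a state has positive probability to all such
  times, and there are finitely many states, so one \<open>h0\<close> serves for all. The Markov property then
  allows any event of the past as an additional condition.\<close>

lemma markov_chain_leave_probability:
  assumes M: "prob_space M" and cad: "cadlag_process M N \<sigma>" and mc: "markov_chain M N \<sigma> \<pi> q"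
    and R: "\<And>i. i \<in> {1..N} \<Longrightarrow> - q i i < R"
  obtains h0 where "h0 > 0" "\<And>h t i A. 0 < h \<Longrightarrow> h < h0 \<Longrightarrow> 0 \<le> t \<Longrightarrow> i \<in> {1..N} \<Longrightarrow> A \<in> past_events M \<sigma> t \<Longrightarrow>
    \<P>(\<omega> in M. \<omega> \<in> A \<and> \<sigma> t \<omega> = i \<and> \<sigma> (t + h) \<omega> \<noteq> i) \<le> R * h * \<P>(\<omega> in M. \<omega> \<in> A \<and> \<sigma> t \<omega> = i)"
proof -
  interpret prob_space M by fact
  let ?p = "\<lambda>t h i. \<P>(\<omega> in M. \<sigma> (t + h) \<omega> = i \<bar> \<sigma> t \<omega> = i)"
  have mark: "\<P>(\<omega> in M. \<sigma> (t + h) \<omega> = i \<bar> \<omega> \<in> A \<and> \<sigma> t \<omega> = i) = ?p t h i"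
    if "t \<ge> 0" "h > 0" "A \<in> past_events M \<sigma> t" "i \<in> {1..N}"
      "\<P>(\<omega> in M. \<omega> \<in> A \<and> \<sigma> t \<omega> = i) > 0" for t h A i
    using mc that unfolding markov_chain_def by simp
  have homog: "?p s h i = ?p t h i"
    if "s \<ge> 0" "t \<ge> 0" "h > 0" "i \<in> {1..N}" "\<P>(\<omega> in M. \<sigma> s \<omega> = i) > 0" "\<P>(\<omega> in M. \<sigma> t \<omega> = i) > 0"
    for s t h i
    using mc that unfolding markov_chain_def by blast
  have gen: "(\<lambda>h. ?p t h i - (1 + q i i * h)) \<in> o[at_right 0](\<lambda>h. h)"
    if "t \<ge> 0" "i \<in> {1..N}" "\<P>(\<omega> in M. \<sigma> t \<omega> = i) > 0" for t i
  proof -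
    have "(\<lambda>h. ?p t h i - ((if i = i then 1 else 0) + q i i * h)) \<in> o[at_right 0](\<lambda>h. h)"
      using mc that unfolding markov_chain_def by blast
    then show ?thesis by simp
  qed
  define ok where "ok i h0 \<longleftrightarrow> h0 > 0 \<and> (\<forall>h t. 0 < h \<longrightarrow> h < h0 \<longrightarrow> 0 \<le> t \<longrightarrow>
      \<P>(\<omega> in M. \<sigma> t \<omega> = i) > 0 \<longrightarrow> ?p t h i \<ge> 1 - R * h)" for i and h0 :: real
  have "\<exists>h0. ok i h0" if i: "i \<in> {1..N}" for i
  proof (cases "\<exists>s\<ge>0. \<P>(\<omega> in M. \<sigma> s \<omega> = i) > 0")
    case False
    then have "ok i 1" by (auto simp: ok_def)
    then show ?thesis ..
  next
    case True
    then obtain s where s: "s \<ge> 0" "\<P>(\<omega> in M. \<sigma> s \<omega> = i) > 0" by blast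
    have "R + q i i > 0" using R[OF i] by simp
    from landau_o.smallD[OF gen[OF s(1) i s(2)] this]
    have "\<forall>\<^sub>F h in at_right 0. norm (?p s h i - (1 + q i i * h)) \<le> (R + q i i) * norm h" .
    then obtain h0 where h0: "h0 > 0"
      "\<forall>h. 0 < h \<longrightarrow> h < h0 \<longrightarrow> norm (?p s h i - (1 + q i i * h)) \<le> (R + q i i) * norm h"
      by (auto simp: eventually_at_right_field)
    have "?p t h i \<ge> 1 - R * h"
      if h: "0 < h" "h < h0" "0 \<le> t" "\<P>(\<omega> in M. \<sigma> t \<omega> = i) > 0" for h t
    proof -
      have "\<bar>?p s h i - (1 + q i i * h)\<bar> \<le> (R + q i i) * h" using h0(2) h by simp
      then have "?p s h i \<ge> 1 - R * h" by (simp add: algebra_simps abs_le_iff)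
      then show ?thesis using homog[OF s(1) h(3,1) i s(2) h(4)] by simp
    qed
    then have "ok i h0" using h0(1) by (simp add: ok_def)
    then show ?thesis ..
  qed
  then obtain H where "\<And>i. i \<in> {1..N} \<Longrightarrow> ok i (H i)" by metis
  then have H: "H i > 0" "0 < h \<Longrightarrow> h < H i \<Longrightarrow> 0 \<le> t \<Longrightarrow> \<P>(\<omega> in M. \<sigma> t \<omega> = i) > 0
       \<Longrightarrow> ?p t h i \<ge> 1 - R * h" if "i \<in> {1..N}" for i h t
    using that unfolding ok_def by blast+
  define h0 where "h0 = Min (insert 1 (H ` {1..N}))"
  have h0: "h0 > 0" "\<And>i. i \<in> {1..N} \<Longrightarrow> h0 \<le> H i"
  proof -
    show "h0 > 0" unfolding h0_def using H(1) by auto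
    show "h0 \<le> H i" if "i \<in> {1..N}" for i unfolding h0_def using that by (intro Min_le) auto
  qed
  show thesis
  proof (rule that[OF h0(1)])
    fix h t i A assume h: "0 < h" "h < h0" "0 \<le> t" "i \<in> {1..N}" and A: "A \<in> past_events M \<sigma> t"
    have [measurable]: "A \<in> sets M" using A past_events_subset_sets[OF cad] by blast
    have [measurable]: "\<sigma> t \<in> measurable M (count_space UNIV)"
      "\<sigma> (t + h) \<in> measurable M (count_space UNIV)"
      using h by (auto intro!: cadlag_process_measurable[OF cad])
    have meas: "{\<omega> \<in> space M. \<omega> \<in> A \<and> \<sigma> t \<omega> = i} \<in> events"
      "{\<omega> \<in> space M. \<sigma> (t + h) \<omega> = i \<and> \<omega> \<in> A \<and> \<sigma> t \<omega> = i} \<in> events"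
      "{\<omega> \<in> space M. \<sigma> t \<omega> = i} \<in> events"
      by measurable
    show "\<P>(\<omega> in M. \<omega> \<in> A \<and> \<sigma> t \<omega> = i \<and> \<sigma> (t + h) \<omega> \<noteq> i) \<le> R * h * \<P>(\<omega> in M. \<omega> \<in> A \<and> \<sigma> t \<omega> = i)"
    proof (cases "\<P>(\<omega> in M. \<omega> \<in> A \<and> \<sigma> t \<omega> = i) > 0")
      case True
      have "\<P>(\<omega> in M. \<omega> \<in> A \<and> \<sigma> t \<omega> = i) \<le> \<P>(\<omega> in M. \<sigma> t \<omega> = i)"
        using meas(3) by (intro finite_measure_mono) auto
      then have "1 - R * h \<le> \<P>(\<omega> in M. \<sigma> (t + h) \<omega> = i \<bar> \<omega> \<in> A \<and> \<sigma> t \<omega> = i)"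
        using H(2)[of i h t, OF h(4)] h0(2)[of i] h True mark[of t h A i] A by auto
      then have "(1 - R * h) * \<P>(\<omega> in M. \<omega> \<in> A \<and> \<sigma> t \<omega> = i)
          \<le> \<P>(\<omega> in M. \<sigma> (t + h) \<omega> = i \<and> \<omega> \<in> A \<and> \<sigma> t \<omega> = i)"
        using True by (simp add: cond_prob_def field_simps)
      moreover have "\<P>(\<omega> in M. \<omega> \<in> A \<and> \<sigma> t \<omega> = i \<and> \<sigma> (t + h) \<omega> \<noteq> i)
          = \<P>(\<omega> in M. \<omega> \<in> A \<and> \<sigma> t \<omega> = i) - \<P>(\<omega> in M. \<sigma> (t + h) \<omega> = i \<and> \<omega> \<in> A \<and> \<sigma> t \<omega> = i)"
        by (subst finite_measure_Diff[symmetric, OF meas(1,2)]) (auto intro!: arg_cong[where f = prob])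
      ultimately show ?thesis by (simp add: algebra_simps)
    next
      case False
      then have "\<P>(\<omega> in M. \<omega> \<in> A \<and> \<sigma> t \<omega> = i) = 0" using measure_nonneg[of M] by (simp add: not_less order_antisym)
      moreover have "\<P>(\<omega> in M. \<omega> \<in> A \<and> \<sigma> t \<omega> = i \<and> \<sigma> (t + h) \<omega> \<noteq> i) \<le> \<P>(\<omega> in M. \<omega> \<in> A \<and> \<sigma> t \<omega> = i)"
        using meas(1) by (intro finite_measure_mono) auto
      ultimately show ?thesis by simp
    qed
  qed
qed

text \<open>Going from \<open>m\<close> to \<open>m + 1\<close> cells multiplies \<open>mu ^ K\<close> by \<open>mu\<close> on the event that the state changes and
  leaves it unchanged otherwise. Conditionally on the value of the count and the present state, that
  event has probability at most \<open>R / 2 ^ n\<close>, so the expectation grows at most by the factor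
  \<open>1 + (mu - 1) * (R / 2 ^ n)\<close>.\<close>

lemma expectation_grid_switches:
  assumes M: "prob_space M" and cad: "cadlag_process M N \<sigma>" and mu: "mu \<ge> 1"
    and R: "R \<ge> 0"
    and leave: "\<And>t i A. 0 \<le> t \<Longrightarrow> i \<in> {1..N} \<Longrightarrow> A \<in> past_events M \<sigma> t \<Longrightarrow>
      \<P>(\<omega> in M. \<omega> \<in> A \<and> \<sigma> t \<omega> = i \<and> \<sigma> (t + 1 / 2 ^ n) \<omega> \<noteq> i)
        \<le> R / 2 ^ n * \<P>(\<omega> in M. \<omega> \<in> A \<and> \<sigma> t \<omega> = i)"
  shows "(\<lambda>\<omega>. grid_switches (\<lambda>t. \<sigma> t \<omega>) n m) \<in> measurable M (count_space UNIV)"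
    and "(\<integral>\<omega>. mu ^ grid_switches (\<lambda>t. \<sigma> t \<omega>) n m \<partial>M) \<le> (1 + (mu - 1) * (R / 2 ^ n)) ^ m"
proof -
  interpret prob_space M by fact
  define K where "K m \<omega> = grid_switches (\<lambda>t. \<sigma> t \<omega>) n m" for m \<omega>
  let ?t = "\<lambda>m. real m / 2 ^ n"
  have \<sigma>N: "\<sigma> u \<omega> \<in> {1..N}" if "u \<ge> 0" "\<omega> \<in> space M" for u \<omega>
    using cad that measurable_space[of "\<sigma> u" M "count_space {1..N}"] unfolding cadlag_process_def by auto
  have past: "{\<omega> \<in> space M. K m \<omega> = k} \<in> past_events M \<sigma> (?t m)" for m k
  proof -
    have "{\<omega> \<in> space M. K m \<omega> = k} = K m -` {k} \<inter> space (past_algebra M \<sigma> (?t m))" by auto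
    also have "\<dots> \<in> sets (past_algebra M \<sigma> (?t m))"
      unfolding K_def
      by (rule measurable_sets[OF grid_switches_measurable_past[OF order_refl]]) simp
    finally show ?thesis by (simp add: sets_past_algebra)
  qed
  have K[measurable]: "K m \<in> measurable M (count_space UNIV)" for m
  proof (rule measurableI)
    fix A :: "nat set"
    have "K m -` A \<inter> space M = (\<Union>k\<in>A. {\<omega> \<in> space M. K m \<omega> = k})" by auto
    also have "\<dots> \<in> sets M"
      using past past_events_subset_sets[OF cad] by (intro sets.countable_UN') auto
    finally show "K m -` A \<inter> space M \<in> sets M" .
  qed auto
  then show "(\<lambda>\<omega>. grid_switches (\<lambda>t. \<sigma> t \<omega>) n m) \<in> measurable M (count_space UNIV)"
    unfolding K_def .
  have Kle: "K m \<omega> \<le> m" for m \<omega> unfolding K_def by (rule grid_switches_le)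
  define A where "A m k i = {\<omega> \<in> space M. K m \<omega> = k \<and> \<sigma> (?t m) \<omega> = i}" for m k i
  define B where "B m k i = {\<omega> \<in> space M. K m \<omega> = k \<and> \<sigma> (?t m) \<omega> = i \<and> \<sigma> (?t (Suc m)) \<omega> \<noteq> i}" for m k i
  have [measurable]: "\<sigma> (?t m) \<in> measurable M (count_space UNIV)" for m
    by (rule cadlag_process_measurable[OF cad]) simp
  have AB[measurable]: "A m k i \<in> events" "B m k i \<in> events" for m k i
    unfolding A_def B_def by measurable
  have e1: "mu ^ K m \<omega> = (\<Sum>k\<le>m. \<Sum>i\<in>{1..N}. mu ^ k * indicator (A m k i) \<omega>)"
    if w: "\<omega> \<in> space M" for m \<omega>
  proof -
    have "(\<Sum>k\<le>m. \<Sum>i\<in>{1..N}. mu ^ k * indicator (A m k i) \<omega>)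
        = (\<Sum>k\<le>m. \<Sum>i\<in>{1..N}. if i = \<sigma> (?t m) \<omega> then (if k = K m \<omega> then mu ^ k else 0) else 0)"
      by (intro sum.cong refl) (auto simp: A_def w indicator_def)
    also have "\<dots> = mu ^ K m \<omega>"
      using \<sigma>N[of "?t m" \<omega>] w Kle[of m \<omega>] by (simp add: sum.delta)
    finally show ?thesis ..
  qed
  have e2: "mu ^ K (Suc m) \<omega> = mu ^ K m \<omega> +
      (mu - 1) * (\<Sum>k\<le>m. \<Sum>i\<in>{1..N}. mu ^ k * indicator (B m k i) \<omega>)"
    if w: "\<omega> \<in> space M" for m \<omega>
  proof -
    have "(\<Sum>k\<le>m. \<Sum>i\<in>{1..N}. mu ^ k * indicator (B m k i) \<omega>)
        = (\<Sum>k\<le>m. \<Sum>i\<in>{1..N}. if i = \<sigma> (?t m) \<omega> then (if k = K m \<omega> then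
            (if \<sigma> (?t m) \<omega> \<noteq> \<sigma> (?t (Suc m)) \<omega> then mu ^ k else 0) else 0) else 0)"
      by (intro sum.cong refl) (auto simp: B_def w indicator_def)
    also have "\<dots> = (if \<sigma> (?t m) \<omega> \<noteq> \<sigma> (?t (Suc m)) \<omega> then mu ^ K m \<omega> else 0)"
      using \<sigma>N[of "?t m" \<omega>] w Kle[of m \<omega>] by (simp add: sum.delta)
    finally show ?thesis unfolding K_def grid_switches_Suc by (auto simp: algebra_simps)
  qed
  have intI: "integrable M (\<lambda>\<omega>. c * indicator S \<omega> :: real)" if "S \<in> events" for c S
    using that by (intro integrable_mult_right integrable_real_indicator) (auto simp: emeasure_eq_measure)
  have int_sum: "integrable M (\<lambda>\<omega>. \<Sum>k\<le>m. \<Sum>i\<in>{1..N}. mu ^ k * indicator (S k i) \<omega>)"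
    and sum_int: "(\<integral>\<omega>. (\<Sum>k\<le>m. \<Sum>i\<in>{1..N}. mu ^ k * indicator (S k i) \<omega>) \<partial>M)
      = (\<Sum>k\<le>m. \<Sum>i\<in>{1..N}. mu ^ k * prob (S k i))"
    if S: "\<And>k i. S k i \<in> events" for S :: "nat \<Rightarrow> nat \<Rightarrow> 'a set" and m
  proof -
    show "integrable M (\<lambda>\<omega>. \<Sum>k\<le>m. \<Sum>i\<in>{1..N}. mu ^ k * indicator (S k i) \<omega>)"
      by (intro Bochner_Integration.integrable_sum intI S)
    have "(\<integral>\<omega>. mu ^ k * indicator (S k i) \<omega> \<partial>M) = mu ^ k * prob (S k i)" for k i
      using S[of k i] by simp
    then show "(\<integral>\<omega>. (\<Sum>k\<le>m. \<Sum>i\<in>{1..N}. mu ^ k * indicator (S k i) \<omega>) \<partial>M)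
      = (\<Sum>k\<le>m. \<Sum>i\<in>{1..N}. mu ^ k * prob (S k i))"
      by (subst Bochner_Integration.integral_sum, intro Bochner_Integration.integrable_sum intI S,
          subst Bochner_Integration.integral_sum, intro intI S, simp only:)
  qed
  have i1: "(\<integral>\<omega>. mu ^ K m \<omega> \<partial>M) = (\<Sum>k\<le>m. \<Sum>i\<in>{1..N}. mu ^ k * prob (A m k i))" for m
    unfolding sum_int[OF AB(1), symmetric] by (rule Bochner_Integration.integral_cong[OF refl e1])
  have i2: "(\<integral>\<omega>. mu ^ K (Suc m) \<omega> \<partial>M) = (\<integral>\<omega>. mu ^ K m \<omega> \<partial>M) +
      (mu - 1) * (\<Sum>k\<le>m. \<Sum>i\<in>{1..N}. mu ^ k * prob (B m k i))" for m
  proof -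
    have int: "integrable M (\<lambda>\<omega>. mu ^ K m \<omega>)"
      by (rule Bochner_Integration.integrable_cong[THEN iffD2, OF refl e1 int_sum[OF AB(1)]])
    have "(\<integral>\<omega>. mu ^ K (Suc m) \<omega> \<partial>M) = (\<integral>\<omega>. mu ^ K m \<omega> +
        (mu - 1) * (\<Sum>k\<le>m. \<Sum>i\<in>{1..N}. mu ^ k * indicator (B m k i) \<omega>) \<partial>M)"
      by (rule Bochner_Integration.integral_cong[OF refl e2])
    also have "\<dots> = (\<integral>\<omega>. mu ^ K m \<omega> \<partial>M) +
        (mu - 1) * (\<Sum>k\<le>m. \<Sum>i\<in>{1..N}. mu ^ k * prob (B m k i))"
      unfolding sum_int[OF AB(2), symmetric]
      by (subst Bochner_Integration.integral_add[OF int])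
        (intro integrable_mult_right int_sum AB, simp only: integral_mult_right_zero)
    finally show ?thesis .
  qed
  have BA: "prob (B m k i) \<le> R / 2 ^ n * prob (A m k i)" if i: "i \<in> {1..N}" for m k i
  proof -
    have "?t m + 1 / 2 ^ n = ?t (Suc m)" by (simp add: add_divide_distrib)
    then show ?thesis
      using leave[OF _ i past[of m k]] by (auto simp: A_def B_def cong: conj_cong)
  qed
  have "(\<integral>\<omega>. mu ^ K m \<omega> \<partial>M) \<le> (1 + (mu - 1) * (R / 2 ^ n)) ^ m"
  proof (induction m)
    case 0
    then show ?case by (simp add: K_def prob_space)
  next
    case (Suc m)
    have "(\<Sum>k\<le>m. \<Sum>i\<in>{1..N}. mu ^ k * prob (B m k i))
        \<le> (\<Sum>k\<le>m. \<Sum>i\<in>{1..N}. mu ^ k * (R / 2 ^ n * prob (A m k i)))"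
      using BA mu by (intro sum_mono mult_left_mono) auto
    also have "\<dots> = R / 2 ^ n * (\<integral>\<omega>. mu ^ K m \<omega> \<partial>M)"
      unfolding i1 sum_distrib_left by (intro sum.cong refl) (simp add: ac_simps)
    finally have "(\<integral>\<omega>. mu ^ K (Suc m) \<omega> \<partial>M) \<le>
        (\<integral>\<omega>. mu ^ K m \<omega> \<partial>M) + (mu - 1) * (R / 2 ^ n * (\<integral>\<omega>. mu ^ K m \<omega> \<partial>M))"
      unfolding i2 using mu by (intro add_left_mono mult_left_mono) auto
    also have "\<dots> = (1 + (mu - 1) * (R / 2 ^ n)) * (\<integral>\<omega>. mu ^ K m \<omega> \<partial>M)"
      by (simp add: algebra_simps)
    also have "\<dots> \<le> (1 + (mu - 1) * (R / 2 ^ n)) * (1 + (mu - 1) * (R / 2 ^ n)) ^ m"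
      using Suc mu R by (intro mult_left_mono) auto
    finally show ?case by simp
  qed
  then show "(\<integral>\<omega>. mu ^ grid_switches (\<lambda>t. \<sigma> t \<omega>) n m \<partial>M) \<le> (1 + (mu - 1) * (R / 2 ^ n)) ^ m"
    unfolding K_def .
qed

text \<open>The expectations of the counts up to time \<open>T\<close> are bounded by \<open>exp ((mu - 1) * R * T)\<close> uniformly in the
  mesh, hence by Fatou's lemma so is that of the limit inferior \<open>H T\<close>. The series of \<open>H T * exp (- lam * T)\<close>
  has finite expectation and therefore converges almost surely. Since \<open>H T\<close> is a limit inferior, values
  below \<open>H T + 1\<close> occur for arbitrarily fine grids, which is what the decay estimate needs: how fine the
  grid must be depends on the path.\<close>

lemma grid_switches_growth:
  assumes M: "prob_space M" and cad: "cadlag_process M N \<sigma>" and mc: "markov_chain M N \<sigma> \<pi> q"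
    and mu: "mu \<ge> 1" and R: "\<And>i. i \<in> {1..N} \<Longrightarrow> - q i i < R" "R \<ge> 0" and lam: "(mu - 1) * R < lam"
  shows "AE \<omega> in M. \<exists>C. C \<longlonglongrightarrow> 0 \<and> (\<forall>T n0. \<exists>n\<ge>n0.
    mu ^ grid_switches (\<lambda>t. \<sigma> t \<omega>) n (T * 2 ^ n) * exp (- lam * real T) \<le> C T)"
proof -
  interpret prob_space M by fact
  define r where "r = (mu - 1) * R"
  have r: "0 \<le> r" "r < lam" using mu R(2) lam by (auto simp: r_def)
  define X where "X T n \<omega> = mu ^ grid_switches (\<lambda>t. \<sigma> t \<omega>) n (T * 2 ^ n)" for T n \<omega>
  obtain h0 where h0: "h0 > 0"
    and leave0: "\<And>h t i A. 0 < h \<Longrightarrow> h < h0 \<Longrightarrow> 0 \<le> t \<Longrightarrow> i \<in> {1..N} \<Longrightarrow> A \<in> past_events M \<sigma> t \<Longrightarrow>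
    \<P>(\<omega> in M. \<omega> \<in> A \<and> \<sigma> t \<omega> = i \<and> \<sigma> (t + h) \<omega> \<noteq> i) \<le> R * h * \<P>(\<omega> in M. \<omega> \<in> A \<and> \<sigma> t \<omega> = i)"
    using markov_chain_leave_probability[OF M cad mc R(1)] by blast
  obtain n1 where n1: "1 / 2 ^ n1 < h0"
    using real_arch_pow_inv[of h0 "1/2"] h0(1) by (auto simp: power_one_over)
  have E: "X T n \<in> borel_measurable M \<and> (\<integral>\<omega>. X T n \<omega> \<partial>M) \<le> exp (r * T)" if n: "n \<ge> n1" for T n
  proof -
    have "(1::real) / 2 ^ n \<le> 1 / 2 ^ n1" using n by (intro divide_left_mono power_increasing) auto
    with n1 have nh: "1 / 2 ^ n < h0" by simp
    have leave: "\<P>(\<omega> in M. \<omega> \<in> A \<and> \<sigma> t \<omega> = i \<and> \<sigma> (t + 1 / 2 ^ n) \<omega> \<noteq> i)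
        \<le> R / 2 ^ n * \<P>(\<omega> in M. \<omega> \<in> A \<and> \<sigma> t \<omega> = i)"
      if "0 \<le> t" "i \<in> {1..N}" "A \<in> past_events M \<sigma> t" for t i A
      using leave0[OF _ nh that] by simp
    note ex = expectation_grid_switches[OF M cad mu R(2) leave, of "T * 2 ^ n"]
    have "(\<integral>\<omega>. X T n \<omega> \<partial>M) \<le> (1 + r / 2 ^ n) ^ (T * 2 ^ n)"
      using ex(2) unfolding X_def r_def times_divide_eq_right .
    also have "\<dots> \<le> exp (r / 2 ^ n) ^ (T * 2 ^ n)"
      using r by (intro power_mono exp_ge_add_one_self) auto
    also have "\<dots> = exp (real (T * 2 ^ n) * (r / 2 ^ n))" by (rule exp_of_nat_mult[symmetric])
    also have "real (T * 2 ^ n) * (r / 2 ^ n) = r * T" by simp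
    finally have "(\<integral>\<omega>. X T n \<omega> \<partial>M) \<le> exp (r * T)" .
    moreover have "X T n \<in> borel_measurable M"
      unfolding X_def[abs_def] by (rule measurable_compose[OF ex(1) borel_measurable_count_space])
    ultimately show ?thesis by blast
  qed
  have X0: "X T n \<omega> \<ge> 0" "X T n \<omega> \<le> mu ^ (T * 2 ^ n)" for T n \<omega>
    using mu grid_switches_le unfolding X_def by (auto intro: power_increasing)
  define H where "H T \<omega> = liminf (\<lambda>n. ennreal (X T (n + n1) \<omega>))" for T \<omega>
  have Xm[measurable]: "X T (n + n1) \<in> borel_measurable M" for T n using E[of "n + n1" T] by simp
  have Hm[measurable]: "H T \<in> borel_measurable M" for T
    unfolding H_def[abs_def] by measurable
  have HE: "(\<integral>\<^sup>+\<omega>. H T \<omega> \<partial>M) \<le> ennreal (exp (r * T))" for T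
  proof -
    have "(\<integral>\<^sup>+\<omega>. H T \<omega> \<partial>M) \<le> liminf (\<lambda>n. \<integral>\<^sup>+\<omega>. ennreal (X T (n + n1) \<omega>) \<partial>M)"
      unfolding H_def by (rule nn_integral_liminf) measurable
    also have "\<dots> \<le> liminf (\<lambda>n. ennreal (exp (r * T)))"
    proof (rule Liminf_mono, rule always_eventually, rule allI)
      fix n
      have "integrable M (X T (n + n1))"
        by (rule integrable_const_bound[of _ "mu ^ (T * 2 ^ (n + n1))"]) (use X0 in auto)
      then have "(\<integral>\<^sup>+\<omega>. ennreal (X T (n + n1) \<omega>) \<partial>M) = ennreal (\<integral>\<omega>. X T (n + n1) \<omega> \<partial>M)"
        using X0 by (intro nn_integral_eq_integral) auto
      then show "(\<integral>\<^sup>+\<omega>. ennreal (X T (n + n1) \<omega>) \<partial>M) \<le> ennreal (exp (r * T))"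
        using E[of "n + n1" T] by (simp add: ennreal_leI)
    qed
    also have "\<dots> = ennreal (exp (r * T))" by (simp add: Liminf_const)
    finally show ?thesis .
  qed
  have "(\<integral>\<^sup>+\<omega>. (\<Sum>T. H T \<omega> * ennreal (exp (- lam * real T))) \<partial>M)
      = (\<Sum>T. \<integral>\<^sup>+\<omega>. H T \<omega> * ennreal (exp (- lam * real T)) \<partial>M)"
    by (rule nn_integral_suminf) measurable
  also have "\<dots> \<le> (\<Sum>T. ennreal (exp (r - lam) ^ T))"
  proof (rule suminf_le)
    fix T
    have "(\<integral>\<^sup>+\<omega>. H T \<omega> * ennreal (exp (- lam * real T)) \<partial>M)
        = (\<integral>\<^sup>+\<omega>. H T \<omega> \<partial>M) * ennreal (exp (- lam * real T))"
      by (rule nn_integral_multc) measurable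
    also have "\<dots> \<le> ennreal (exp (r * T)) * ennreal (exp (- lam * real T))"
      by (intro mult_right_mono HE) simp
    also have "\<dots> = ennreal (exp (r - lam) ^ T)"
      by (simp add: ennreal_mult[symmetric] exp_add[symmetric] exp_of_nat_mult[symmetric] algebra_simps)
    finally show "(\<integral>\<^sup>+\<omega>. H T \<omega> * ennreal (exp (- lam * real T)) \<partial>M) \<le> ennreal (exp (r - lam) ^ T)" .
  qed auto
  also have "\<dots> < \<infinity>"
  proof -
    have "summable (\<lambda>T. exp (r - lam) ^ T)" using r by (intro summable_geometric) auto
    then show ?thesis by (subst suminf_ennreal2) auto
  qed
  finally have "AE \<omega> in M. (\<Sum>T. H T \<omega> * ennreal (exp (- lam * real T))) \<noteq> \<infinity>"
    by (intro nn_integral_noteq_infinite) (auto simp: less_top)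
  then show ?thesis
  proof eventually_elim
    case (elim \<omega>)
    have Hfin: "H T \<omega> \<noteq> \<infinity>" for T
    proof
      assume "H T \<omega> = \<infinity>"
      then have "H T \<omega> * ennreal (exp (- lam * real T)) = \<infinity>" by (simp add: ennreal_top_mult)
      moreover have "H T \<omega> * ennreal (exp (- lam * real T)) \<le> (\<Sum>T. H T \<omega> * ennreal (exp (- lam * real T)))"
        using sum_le_suminf[of "\<lambda>T. H T \<omega> * ennreal (exp (- lam * real T))" "{T}"] by simp
      ultimately show False using elim by (simp add: top_unique)
    qed
    define c where "c T = enn2real (H T \<omega>)" for T
    have Hc: "H T \<omega> = ennreal (c T)" "c T \<ge> 0" for T using Hfin[of T] by (auto simp: c_def less_top)
    have "(\<lambda>T. H T \<omega> * ennreal (exp (- lam * real T))) = (\<lambda>T. ennreal (c T * exp (- lam * real T)))"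
      using Hc by (simp add: ennreal_mult)
    with elim have "(\<Sum>T. ennreal (c T * exp (- lam * real T))) \<noteq> \<infinity>" by simp
    then have "summable (\<lambda>T. c T * exp (- lam * real T))"
      using Hc(2) by (intro summable_suminf_not_top) auto
    then have lim1: "(\<lambda>T. c T * exp (- lam * real T)) \<longlonglongrightarrow> 0" by (rule summable_LIMSEQ_zero)
    have "(\<lambda>T. exp (- lam) ^ T) \<longlonglongrightarrow> 0" using r by (intro LIMSEQ_power_zero) auto
    then have lim2: "(\<lambda>T. exp (- lam * real T)) \<longlonglongrightarrow> 0"
      by (simp add: exp_of_nat_mult[symmetric] mult.commute)
    have "(\<lambda>T. (c T + 1) * exp (- lam * real T)) \<longlonglongrightarrow> 0"
      using tendsto_add[OF lim1 lim2] by (simp add: algebra_simps)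
    moreover have "\<exists>n\<ge>n0. X T n \<omega> * exp (- lam * real T) \<le> (c T + 1) * exp (- lam * real T)" for T n0
    proof -
      have "\<exists>n\<ge>n0. X T n \<omega> \<le> c T + 1"
      proof (rule ccontr)
        assume "\<not> ?thesis"
        then have "\<forall>n\<ge>n0. c T + 1 \<le> X T n \<omega>" by auto
        then have "\<forall>\<^sub>F n in sequentially. ennreal (c T + 1) \<le> ennreal (X T (n + n1) \<omega>)"
          unfolding eventually_sequentially by (intro exI[of _ n0] allI impI ennreal_leI) auto
        then have "ennreal (c T + 1) \<le> H T \<omega>" unfolding H_def by (rule Liminf_bounded)
        then show False using Hc[of T] by (simp add: ennreal_le_iff)
      qed
      then show ?thesis by auto
    qed
    ultimately show ?case unfolding X_def by (intro exI[of _ "\<lambda>T. (c T + 1) * exp (- lam * real T)"]) blast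
  qed
qed

section \<open>Switched systems with a family of Lyapunov functions\<close>

lemma class_K_infinity_ge:
  assumes "class_K_infinity \<alpha>"
  obtains R where "R > 0" "\<And>r. r \<ge> R \<Longrightarrow> \<alpha> r > c"
proof -
  have "filterlim \<alpha> at_top at_top" using assms by (simp add: class_K_infinity_def)
  then have "\<forall>\<^sub>F r in at_top. c < \<alpha> r" by (simp add: filterlim_at_top_dense)
  then obtain R where "\<And>r. r \<ge> R \<Longrightarrow> \<alpha> r > c" by (auto simp: eventually_at_top_linorder)
  then show thesis by (intro that[of "max R 1"]) auto
qed

lemma class_K_infinityD:
  assumes "class_K_infinity \<alpha>"
  shows "\<alpha> 0 = 0" "0 \<le> u \<Longrightarrow> u < v \<Longrightarrow> \<alpha> u < \<alpha> v" "0 \<le> u \<Longrightarrow> u \<le> v \<Longrightarrow> \<alpha> u \<le> \<alpha> v"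
    "continuous_on {0..} \<alpha>"
proof -
  have *: "\<alpha> 0 = 0" "strict_mono_on {0..} \<alpha>" "continuous_on {0..} \<alpha>"
    using assms by (auto simp: class_K_infinity_def class_K_def)
  then show "\<alpha> 0 = 0" "continuous_on {0..} \<alpha>" by auto
  show lt: "\<alpha> u < \<alpha> v" if "0 \<le> u" "u < v" for u v
    using strict_mono_onD[OF *(2), of u v] that by simp
  show "0 \<le> u \<Longrightarrow> u \<le> v \<Longrightarrow> \<alpha> u \<le> \<alpha> v" using lt[of u v] by (cases "u = v") auto
qed

text \<open>A Lipschitz function that is \<open>1\<close> on the ball of radius \<open>R\<close> and \<open>0\<close> outside the ball of radius \<open>2 * R\<close>.
  Multiplication by a scalar in \<open>[0, 1]\<close> keeps the direction of the vector field, hence also the sign of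
  the derivative of a Lyapunov function along it.\<close>

definition cutoff :: "real \<Rightarrow> 'a::real_normed_vector \<Rightarrow> real" where
  "cutoff R z = max 0 (min 1 (2 - norm z / R))"

lemma cutoff_bounds: "0 \<le> cutoff R z" "cutoff R z \<le> 1"
  by (auto simp: cutoff_def)

lemma cutoff_eq_1: "R > 0 \<Longrightarrow> norm z \<le> R \<Longrightarrow> cutoff R z = 1"
  by (auto simp: cutoff_def min_def max_def divide_le_eq_1 field_simps)

lemma cutoff_eq_0: "R > 0 \<Longrightarrow> norm z > 2 * R \<Longrightarrow> cutoff R z = 0"
  by (auto simp: cutoff_def min_def max_def field_simps)

lemma cutoff_lipschitz:
  assumes "R > 0"
  shows "\<bar>cutoff R x - cutoff R y\<bar> \<le> norm (x - y) / R"
proof -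
  have "\<bar>cutoff R x - cutoff R y\<bar> \<le> \<bar>norm x / R - norm y / R\<bar>"
    unfolding cutoff_def by (simp add: max_def min_def abs_if)
  also have "\<dots> = \<bar>norm x - norm y\<bar> / R" using assms by (simp add: diff_divide_distrib[symmetric])
  also have "\<dots> \<le> norm (x - y) / R" using assms by (intro divide_right_mono norm_triangle_ineq3) auto
  finally show ?thesis .
qed

lemma cutoff_field_bounds:
  fixes g :: "'a::euclidean_space \<Rightarrow> 'a"
  assumes g: "local_lipschitz (UNIV :: real set) UNIV (\<lambda>_. g)" and R: "R > 0"
  obtains L B where "L \<ge> 0" "\<And>x y. norm (cutoff R x *\<^sub>R g x - cutoff R y *\<^sub>R g y) \<le> L * norm (x - y)"
    "\<And>x. norm (cutoff R x *\<^sub>R g x) \<le> B"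
proof -
  define K where "K = cball (0::'a) (2 * R)"
  obtain L where "\<And>t. t \<in> {0::real} \<Longrightarrow> L-lipschitz_on K g"
    using local_lipschitz_compact_implies_lipschitz[where X = K and T = "{0::real}" and f = "\<lambda>_. g"]
      local_lipschitz_subset[OF g, of "{0}" K] by (auto simp: K_def)
  then have L: "L-lipschitz_on K g" by blast
  note L0 = lipschitz_on_nonneg[OF L]
  have "compact (g ` K)"
    by (intro compact_continuous_image lipschitz_on_continuous_on[OF L]) (simp add: K_def)
  then obtain B where B: "\<And>x. x \<in> K \<Longrightarrow> norm (g x) \<le> B"
    using compact_imp_bounded bounded_iff by (metis image_eqI)
  have B0: "B \<ge> 0" using order_trans[OF norm_ge_zero B[of 0]] R by (simp add: K_def)
  have out: "cutoff R x = 0" if "x \<notin> K" for x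
    using that R by (intro cutoff_eq_0) (auto simp: K_def)
  have one: "norm ((cutoff R x - cutoff R y) *\<^sub>R g y) \<le> (B / R) * norm (x - y)" if "y \<in> K" for x y
  proof -
    have "norm ((cutoff R x - cutoff R y) *\<^sub>R g y) \<le> (norm (x - y) / R) * B"
      unfolding norm_scaleR real_norm_def
      using cutoff_lipschitz[OF R, of x y] B[OF that] R by (intro mult_mono) auto
    then show ?thesis by (simp add: field_simps)
  qed
  have lip: "norm (cutoff R x *\<^sub>R g x - cutoff R y *\<^sub>R g y) \<le> (L + B / R) * norm (x - y)" for x y
  proof (cases "y \<in> K")
    case y: True
    show ?thesis
    proof (cases "x \<in> K")
      case True
      have "cutoff R x *\<^sub>R g x - cutoff R y *\<^sub>R g y
          = cutoff R x *\<^sub>R (g x - g y) + (cutoff R x - cutoff R y) *\<^sub>R g y" by (simp add: algebra_simps)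
      also have "norm \<dots> \<le> norm (cutoff R x *\<^sub>R (g x - g y)) + norm ((cutoff R x - cutoff R y) *\<^sub>R g y)"
        by (rule norm_triangle_ineq)
      also have "norm (cutoff R x *\<^sub>R (g x - g y)) \<le> 1 * (L * norm (x - y))"
        unfolding norm_scaleR using lipschitz_onD[OF L True y] cutoff_bounds[of R x]
        by (intro mult_mono) (auto simp: dist_norm)
      finally show ?thesis using one[OF y, of x] by (simp add: algebra_simps)
    next
      case False
      have "(B / R) * norm (x - y) \<le> (L + B / R) * norm (x - y)" using L0 by (intro mult_right_mono) auto
      then show ?thesis using one[OF y, of x] out[OF False] by simp
    qed
  next
    case y: False
    show ?thesis
    proof (cases "x \<in> K")
      case True
      have "(B / R) * norm (x - y) \<le> (L + B / R) * norm (x - y)" using L0 by (intro mult_right_mono) auto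
      then show ?thesis using one[OF True, of y] out[OF y] by (simp add: norm_minus_commute)
    next
      case False
      then show ?thesis using out y L0 B0 R by simp
    qed
  qed
  have bnd: "norm (cutoff R x *\<^sub>R g x) \<le> B" for x
  proof (cases "x \<in> K")
    case True
    have "norm (cutoff R x *\<^sub>R g x) \<le> 1 * norm (g x)"
      unfolding norm_scaleR using cutoff_bounds[of R x] by (intro mult_right_mono) auto
    then show ?thesis using B[OF True] by simp
  qed (use out B0 in simp)
  show thesis by (rule that[OF _ lip bnd]) (use L0 B0 R in simp)
qed

locale lyapunov_family =
  fixes P :: "nat set" and f :: "nat \<Rightarrow> 'a::euclidean_space \<Rightarrow> 'a" and V :: "nat \<Rightarrow> 'a \<Rightarrow> real"
    and V' :: "nat \<Rightarrow> 'a \<Rightarrow> 'a \<Rightarrow> real" and \<alpha>\<^sub>1 \<alpha>\<^sub>2 :: "real \<Rightarrow> real" and lam mu :: real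
  assumes finite_P: "finite P"
    and f_lip: "p \<in> P \<Longrightarrow> local_lipschitz (UNIV :: real set) UNIV (\<lambda>_. f p)"
    and V_deriv: "p \<in> P \<Longrightarrow> (V p has_derivative V' p z) (at z)"
    and V_decay: "p \<in> P \<Longrightarrow> V' p z (f p z) \<le> - lam * V p z"
    and V_nonneg: "p \<in> P \<Longrightarrow> V p z \<ge> 0"
    and V_bounds: "p \<in> P \<Longrightarrow> \<alpha>\<^sub>1 (norm z) \<le> V p z" "p \<in> P \<Longrightarrow> V p z \<le> \<alpha>\<^sub>2 (norm z)"
    and V_compare: "p \<in> P \<Longrightarrow> p' \<in> P \<Longrightarrow> V p z \<le> mu * V p' z"
    and K_inf: "class_K_infinity \<alpha>\<^sub>1" "class_K_infinity \<alpha>\<^sub>2"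
    and lam_pos: "lam > 0" and mu_ge_1: "mu \<ge> 1"
begin

text \<open>The velocity \<open>D\<close> and the rate \<open>c\<close> are kept general because the estimate is used both for the cut-off
  fields with \<open>c = 0\<close> and for the original ones with \<open>c = lam\<close>.\<close>

lemma curve_decay:
  assumes sP: "\<And>t. t \<ge> 0 \<Longrightarrow> s t \<in> P" and fine: "fine_grid s T n"
    and x: "\<And>b. continuous_on {0..b} x"
    and der: "\<And>t. t > 0 \<Longrightarrow> t \<notin> jump_times s \<Longrightarrow> (x has_vector_derivative D t) (at t)"
    and dec: "\<And>t. t > 0 \<Longrightarrow> V' (s t) (x t) (D t) \<le> - c * V (s t) (x t)"
    and t: "t \<in> {0..real T}"
  shows "V (s t) (x t) \<le> mu ^ Suc (grid_switches s n (T * 2 ^ n)) * exp (- c * t) * V (s 0) (x 0)"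
proof (rule switched_decay[where v = "\<lambda>p t. V p (x t)" and P = P, OF fine sP mu_ge_1 _ _ _ t])
  fix p a b assume p: "p \<in> P" and ab: "0 \<le> a" "a < b" and s: "\<And>u. u \<in> {a..<b} \<Longrightarrow> s u = p"
  show "V p (x b) \<le> exp (- c * (b - a)) * V p (x a)"
  proof (rule lyapunov_decay[OF V_deriv[OF p] _ ab(2)])
    show "continuous_on {a..b} x" by (rule continuous_on_subset[OF x[of b]]) (use ab in auto)
    fix t assume t: "t \<in> {a<..<b}"
    then show "(x has_vector_derivative D t) (at t)"
      using not_jump_time_interior[OF s ab(1) t] ab by (intro der) auto
    show "V' p (x t) (D t) \<le> - c * V p (x t)"
      using dec[of t] s[of t] t ab by simp
  qed
qed (use V_nonneg V_compare in auto)

lemma cutoff_solution: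
  assumes s: "step_signal s" and sP: "\<And>t. t \<ge> 0 \<Longrightarrow> s t \<in> P" and R: "R > 0"
  obtains x B where "x 0 = x0" "continuous_on UNIV x"
    "\<And>u v. 0 \<le> u \<Longrightarrow> u \<le> v \<Longrightarrow> dist (x u) (x v) \<le> B * (v - u)"
    "\<And>t. t > 0 \<Longrightarrow> t \<notin> jump_times s \<Longrightarrow>
      (x has_vector_derivative cutoff R (x t) *\<^sub>R f (s t) (x t)) (at t)"
proof -
  define g where "g p x = cutoff R x *\<^sub>R f p x" for p x
  have "\<exists>L B. L \<ge> 0 \<and> (\<forall>x y. norm (g p x - g p y) \<le> L * norm (x - y)) \<and> (\<forall>x. norm (g p x) \<le> B)"
    if p: "p \<in> P" for p
    using cutoff_field_bounds[OF f_lip[OF p] R] unfolding g_def by metis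
  then obtain L B where LB: "\<And>p. p \<in> P \<Longrightarrow> L p \<ge> 0"
    "\<And>p x y. p \<in> P \<Longrightarrow> norm (g p x - g p y) \<le> L p * norm (x - y)"
    "\<And>p x. p \<in> P \<Longrightarrow> norm (g p x) \<le> B p" by metis
  have B0: "B p \<ge> 0" if "p \<in> P" for p using LB(3)[OF that, of 0] norm_ge_zero order_trans by blast
  define L' where "L' = (\<Sum>p\<in>P. L p)"
  define B' where "B' = (\<Sum>p\<in>P. B p)"
  have L': "L' \<ge> 0" "L p \<le> L'" if "p \<in> P" for p
    unfolding L'_def using that finite_P LB(1) by (auto intro!: sum_nonneg member_le_sum)
  have B': "B p \<le> B'" if "p \<in> P" for p
    unfolding B'_def using that finite_P B0 by (auto intro!: member_le_sum)
  have sP': "s (max 0 t) \<in> P" for t by (rule sP) simp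
  have gc: "continuous_on UNIV (g p)" if "p \<in> P" for p
    by (rule lipschitz_on_continuous_on[of "L p"], rule lipschitz_onI)
      (use LB that in \<open>auto simp: dist_norm\<close>)
  define F where "F t x = g (s (max 0 t)) x" for t x
  have contF: "isCont (\<lambda>u. F u (y u)) t" if "continuous_on UNIV y" "t \<notin> jump_times s" for y t
    unfolding F_def by (rule isCont_switched[where g = g, OF that(2) gc[OF sP'] that(1)])
  obtain x where x: "x 0 = x0" "continuous_on UNIV x"
    "\<And>u v. 0 \<le> u \<Longrightarrow> u \<le> v \<Longrightarrow> dist (x u) (x v) \<le> B' * (v - u)"
    "\<And>t. 0 < t \<Longrightarrow> isCont (\<lambda>s. F s (x s)) t \<Longrightarrow> (x has_vector_derivative F t (x t)) (at t)"
  proof (rule bounded_lipschitz_ivp[of F L' B' x0])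
    fix y :: "real \<Rightarrow> 'a" assume y: "continuous_on UNIV y"
    show "(\<lambda>t. F t (y t)) \<in> borel_measurable borel"
      by (rule borel_measurable_continuous_countable_exceptions[OF countable_jump_times[OF s]])
        (intro continuous_at_imp_continuous_on ballI contF[OF y], simp)
  next
    fix t x y
    have "norm (F t x - F t y) \<le> L (s (max 0 t)) * norm (x - y)" unfolding F_def using LB(2) sP' .
    also have "\<dots> \<le> L' * norm (x - y)" using L'(2)[OF sP'] by (intro mult_right_mono) auto
    finally show "norm (F t x - F t y) \<le> L' * norm (x - y)" .
    show "norm (F t x) \<le> B'" unfolding F_def using LB(3)[OF sP'] B'[OF sP'] by (rule order_trans)
  next
    show "L' \<ge> 0" by (rule L'(1)[OF sP'])
  qed (rule that)
  show thesis
  proof (rule that[OF x(1-3)])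
    fix t :: real assume t: "t > 0" "t \<notin> jump_times s"
    show "(x has_vector_derivative cutoff R (x t) *\<^sub>R f (s t) (x t)) (at t)"
      using x(4)[OF t(1) contF[OF x(2) t(2)]] t(1) by (simp add: F_def g_def)
  qed
qed

text \<open>The Lyapunov functions do not increase along the cut-off fields between switches, so their values up
  to time \<open>T\<close> are bounded by a constant \<open>G\<close> that does not depend on the cut-off radius. If \<open>\<alpha>\<^sub>1\<close> exceeds
  \<open>G\<close> beyond \<open>R\<close>, the solution of the problem cut off at \<open>R\<close> stays where the cut-off is inactive.\<close>

lemma solution_upto:
  assumes s: "step_signal s" and sP: "\<And>t. t \<ge> 0 \<Longrightarrow> s t \<in> P"
  shows "\<exists>x. x 0 = x0 \<and> abs_continuous_on_interval 0 (real T) x \<and>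
    (\<forall>t. 0 < t \<longrightarrow> t < real T \<longrightarrow> t \<notin> jump_times s \<longrightarrow> (x has_vector_derivative f (s t) (x t)) (at t))"
proof -
  obtain n where fine: "fine_grid s T n" using ex_fine_grid[OF s] by blast
  define G where "G = mu ^ Suc (grid_switches s n (T * 2 ^ n)) * \<alpha>\<^sub>2 (norm x0)"
  obtain R where R: "R > 0" "\<And>r. r \<ge> R \<Longrightarrow> \<alpha>\<^sub>1 r > G"
    using class_K_infinity_ge[OF K_inf(1)] by blast
  obtain x B where x: "x 0 = x0" "continuous_on UNIV x"
    "\<And>u v. 0 \<le> u \<Longrightarrow> u \<le> v \<Longrightarrow> dist (x u) (x v) \<le> B * (v - u)"
    "\<And>t. t > 0 \<Longrightarrow> t \<notin> jump_times s \<Longrightarrow>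
      (x has_vector_derivative cutoff R (x t) *\<^sub>R f (s t) (x t)) (at t)"
    using cutoff_solution[OF s sP R(1)] by blast
  have dec: "V' p z (cutoff R z *\<^sub>R f p z) \<le> - 0 * V p z" if p: "p \<in> P" for p z
  proof -
    have "V' p z (cutoff R z *\<^sub>R f p z) = cutoff R z * V' p z (f p z)"
      using linear_scale[OF has_derivative_linear[OF V_deriv[OF p]]] by simp
    also have "\<dots> \<le> 0"
      using V_decay[OF p, of z] V_nonneg[OF p, of z] lam_pos cutoff_bounds(1)[of R z]
      by (intro mult_nonneg_nonpos) (auto intro: order_trans)
    finally show ?thesis by simp
  qed
  have small: "norm (x t) \<le> R" if t: "t \<in> {0..real T}" for t
  proof (rule ccontr)
    assume *: "\<not> norm (x t) \<le> R"
    have "V (s t) (x t) \<le> mu ^ Suc (grid_switches s n (T * 2 ^ n)) * exp (- 0 * t) * V (s 0) (x 0)"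
    proof (rule curve_decay[OF sP fine _ x(4) dec t])
      show "continuous_on {0..b} x" for b by (rule continuous_on_subset[OF x(2)]) simp
    qed (use sP in auto)
    also have "\<dots> = mu ^ Suc (grid_switches s n (T * 2 ^ n)) * V (s 0) x0" using x(1) by simp
    also have "\<dots> \<le> G" unfolding G_def
      using V_bounds(2)[OF sP[of 0], of x0] mu_ge_1 by (intro mult_left_mono) auto
    finally have "V (s t) (x t) \<le> G" .
    moreover have "\<alpha>\<^sub>1 (norm (x t)) \<le> V (s t) (x t)" using V_bounds(1) sP t by simp
    ultimately show False using R(2)[of "norm (x t)"] * by simp
  qed
  have "(x has_vector_derivative f (s t) (x t)) (at t)"
    if "0 < t" "t < real T" "t \<notin> jump_times s" for t
    using x(4)[OF that(1,3)] cutoff_eq_1[OF R(1) small[of t]] that by simp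
  moreover have "abs_continuous_on_interval 0 (real T) x"
    by (rule lipschitz_imp_abs_continuous) (use x(3) in auto)
  ultimately show ?thesis using x(1) by blast
qed

text \<open>The solutions for integer horizons agree where they are both defined. The value at time \<open>t\<close> is
  taken from the horizon \<open>\<lceil>t\<rceil> + 1\<close>, which leaves room for a two-sided derivative at \<open>t\<close>.\<close>

lemma global_solution:
  assumes s: "step_signal s" and sP: "\<And>t. t \<ge> 0 \<Longrightarrow> s t \<in> P"
  shows "\<exists>x. unique_caratheodory_solution f s x0 x \<and>
    (\<forall>t>0. t \<notin> jump_times s \<longrightarrow> (x has_vector_derivative f (s t) (x t)) (at t))"
proof -
  obtain X where X: "\<And>T. X T 0 = x0" "\<And>T. abs_continuous_on_interval 0 (real T) (X T)"
    "\<And>T t. 0 < t \<Longrightarrow> t < real T \<Longrightarrow> t \<notin> jump_times s \<Longrightarrow>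
      (X T has_vector_derivative f (s t) (X T t)) (at t)"
    using solution_upto[OF s sP, of x0] by metis
  have X_AE: "AE t in lborel. t \<in> {0..b} \<longrightarrow> (X T has_vector_derivative f (s t) (X T t)) (at t)"
    if "b \<le> real T" for T b
    by (rule AE_off_jump_times[OF s]) (use X(3) that in auto)
  have agree: "X j t = X k t" if "0 \<le> t" "t \<le> real j" "t \<le> real k" for j k t
  proof (rule caratheodory_unique[OF finite_P sP f_lip])
    show "t \<in> {0..min (real j) (real k)}" using that by simp
    show "abs_continuous_on_interval 0 (min (real j) (real k)) (X j)"
      "abs_continuous_on_interval 0 (min (real j) (real k)) (X k)"
      by (auto intro: abs_continuous_on_subinterval[OF X(2)])
    show "AE t in lborel. t \<in> {0..min (real j) (real k)} \<longrightarrow>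
        (X j has_vector_derivative f (s t) (X j t)) (at t)" by (rule X_AE) simp
    show "AE t in lborel. t \<in> {0..min (real j) (real k)} \<longrightarrow>
        (X k has_vector_derivative f (s t) (X k t)) (at t)" by (rule X_AE) simp
  qed (use X(1) in auto)
  define x where "x t = X (Suc (nat \<lceil>t\<rceil>)) t" for t
  have xX: "x t = X k t" if "0 \<le> t" "t \<le> real k" for t k
    unfolding x_def by (rule agree) (use that in linarith)+
  have der: "(x has_vector_derivative f (s t) (x t)) (at t)" if t: "t > 0" "t \<notin> jump_times s" for t
  proof -
    define k where "k = Suc (nat \<lceil>t\<rceil>)"
    have k: "t < real k" unfolding k_def by linarith
    have "(X k has_vector_derivative f (s t) (x t)) (at t)"
      using X(3)[OF t(1) k t(2)] xX[of t k] t k by simp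
    then show ?thesis
      by (rule has_vector_derivative_transform_within_open[where S = "{0<..<real k}"])
        (use t k xX[of _ k] in auto)
  qed
  have ac: "abs_continuous_on_interval 0 T x" if "T \<ge> 0" for T
  proof -
    have T: "T \<le> real (nat \<lceil>T\<rceil>)" by linarith
    show ?thesis
    proof (rule abs_continuous_cong[OF abs_continuous_on_subinterval[OF X(2) order_refl T]])
      show "X (nat \<lceil>T\<rceil>) t = x t" if "t \<in> {0..T}" for t
        by (intro xX[symmetric] order_trans[OF _ T]) (use that in auto)
    qed
  qed
  have sol: "caratheodory_solution f s x0 x"
    unfolding caratheodory_solution_def
  proof (intro conjI allI impI ac)
    show "x 0 = x0" using X(1) by (simp add: x_def)
    show "AE t in lborel. 0 \<le> t \<longrightarrow> (x has_vector_derivative f (s t) (x t)) (at t)"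
    proof (rule AE_I')
      show "jump_times s \<union> {0} \<in> null_sets lborel"
        by (rule countable_imp_null_set_lborel) (use countable_jump_times[OF s] in auto)
    qed (use der in force)
  qed
  have "y t = x t" if y: "caratheodory_solution f s x0 y" and t: "t \<ge> 0" for y t
  proof (rule caratheodory_unique[OF finite_P sP f_lip])
    show "t \<in> {0..t}" using t by simp
    show "abs_continuous_on_interval 0 t y" "abs_continuous_on_interval 0 t x" "y 0 = x 0"
      using y sol t by (auto simp: caratheodory_solution_def)
    show "AE u in lborel. u \<in> {0..t} \<longrightarrow> (y has_vector_derivative f (s u) (y u)) (at u)"
      using y unfolding caratheodory_solution_def by (auto elim: eventually_mono)
    show "AE u in lborel. u \<in> {0..t} \<longrightarrow> (x has_vector_derivative f (s u) (x u)) (at u)"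
      using sol unfolding caratheodory_solution_def by (auto elim: eventually_mono)
  qed auto
  then show ?thesis using sol der unfolding unique_caratheodory_solution_def by blast
qed

lemma solution_decay:
  assumes s: "step_signal s" and sP: "\<And>t. t \<ge> 0 \<Longrightarrow> s t \<in> P"
    and x: "caratheodory_solution f s x0 x" and fine: "fine_grid s T n" and t: "t \<in> {0..real T}"
  shows "V (s t) (x t) \<le> mu ^ Suc (grid_switches s n (T * 2 ^ n)) * exp (- lam * t) * V (s 0) x0"
proof -
  obtain y where y: "unique_caratheodory_solution f s x0 y"
    and der: "\<And>t. t > 0 \<Longrightarrow> t \<notin> jump_times s \<Longrightarrow> (y has_vector_derivative f (s t) (y t)) (at t)"
    using global_solution[OF s sP, of x0] by blast
  have xy: "x t = y t" if "t \<ge> 0" for t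
    using y x that unfolding unique_caratheodory_solution_def by blast
  have y0: "y 0 = x0" and ac: "\<And>T. T \<ge> 0 \<Longrightarrow> abs_continuous_on_interval 0 T y"
    using y unfolding unique_caratheodory_solution_def caratheodory_solution_def by auto
  have cont: "continuous_on {0..b} y" for b
    using abs_continuous_imp_continuous_on[OF ac[of b]] by (cases "b \<ge> 0") auto
  have "V (s t) (y t) \<le> mu ^ Suc (grid_switches s n (T * 2 ^ n)) * exp (- lam * t) * V (s 0) (y 0)"
    by (rule curve_decay[OF sP fine cont der V_decay t]) (use sP in auto)
  then show ?thesis using xy[of t] y0 t by simp
qed

text \<open>The sequence \<open>C\<close> is independent of the initial state. For \<open>T - 1 < t \<le> T\<close> the decay estimate on the
  horizon \<open>T\<close> loses a factor \<open>mu\<close> from the grid and a factor \<open>exp lam\<close> from replacing \<open>t\<close> by \<open>T\<close>. The first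
  property uses that \<open>C\<close> is bounded, and the second that it tends to zero.\<close>

lemma pathwise_stability:
  assumes s: "step_signal s" and sP: "\<And>t. t \<ge> 0 \<Longrightarrow> s t \<in> P"
    and x: "\<And>x0. caratheodory_solution f s x0 (x x0)"
    and C: "C \<longlonglongrightarrow> 0" "\<And>T n0. \<exists>n\<ge>n0. mu ^ grid_switches s n (T * 2 ^ n) * exp (- lam * real T) \<le> C T"
  shows "\<forall>\<epsilon>>0. \<exists>\<delta>>0. \<forall>x0. norm x0 < \<delta> \<longrightarrow> (SUP t\<in>{0..}. ereal (norm (x x0 t))) < ereal \<epsilon>"
    and "\<forall>r>0. \<forall>\<epsilon>>0. \<exists>T\<ge>0. \<forall>x0. norm x0 < r \<longrightarrow> (SUP t\<in>{T..}. ereal (norm (x x0 t))) < ereal \<epsilon>"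
proof -
  define A where "A = mu * exp lam"
  have A: "A > 0" using mu_ge_1 by (simp add: A_def)
  have C0: "C T \<ge> 0" for T
  proof -
    obtain n where "mu ^ grid_switches s n (T * 2 ^ n) * exp (- lam * real T) \<le> C T" using C(2)[of 0 T] by blast
    moreover have "0 \<le> mu ^ grid_switches s n (T * 2 ^ n) * exp (- lam * real T)" using mu_ge_1 by simp
    ultimately show ?thesis by linarith
  qed
  have bound: "\<alpha>\<^sub>1 (norm (x x0 t)) \<le> A * C (nat \<lceil>t\<rceil>) * \<alpha>\<^sub>2 (norm x0)" if t: "t \<ge> 0" for x0 t
  proof -
    define T where "T = nat \<lceil>t\<rceil>"
    have T: "t \<le> real T" "real T \<le> t + 1" unfolding T_def using t by linarith+
    obtain n0 where n0: "\<And>n. n \<ge> n0 \<Longrightarrow> fine_grid s T n" using ex_fine_grid[OF s] by metis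
    obtain n where n: "n \<ge> n0" "mu ^ grid_switches s n (T * 2 ^ n) * exp (- lam * real T) \<le> C T"
      using C(2) by blast
    let ?m = "mu ^ grid_switches s n (T * 2 ^ n)"
    have nn: "0 \<le> V (s 0) x0" using V_nonneg sP by simp
    have "exp (- lam * t) \<le> exp (lam + - lam * real T)"
      using mult_left_mono[OF T(2), of lam] lam_pos by (simp add: algebra_simps)
    then have e: "exp (- lam * t) \<le> exp lam * exp (- lam * real T)" by (simp only: exp_add)
    have "\<alpha>\<^sub>1 (norm (x x0 t)) \<le> V (s t) (x x0 t)" using V_bounds(1) sP t by simp
    also have "\<dots> \<le> mu ^ Suc (grid_switches s n (T * 2 ^ n)) * exp (- lam * t) * V (s 0) x0"
      by (rule solution_decay[OF s sP x n0[OF n(1)]]) (use t T in auto)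
    also have "\<dots> \<le> mu ^ Suc (grid_switches s n (T * 2 ^ n)) * (exp lam * exp (- lam * real T)) * V (s 0) x0"
      using e nn mu_ge_1 by (intro mult_right_mono mult_left_mono) auto
    also have "\<dots> = A * (?m * exp (- lam * real T)) * V (s 0) x0" by (simp add: A_def ac_simps)
    also have "\<dots> \<le> A * C T * V (s 0) x0"
      using n(2) A nn by (intro mult_right_mono mult_left_mono) auto
    also have "\<dots> \<le> A * C T * \<alpha>\<^sub>2 (norm x0)"
      using V_bounds(2)[OF sP[of 0], of x0] A C0[of T] by (intro mult_left_mono) auto
    finally show ?thesis unfolding T_def .
  qed
  have small: "(SUP t\<in>{T..}. ereal (norm (x x0 t))) < ereal \<epsilon>"
    if e: "\<epsilon> > 0" and T: "T \<ge> 0" and lt: "\<And>t. t \<ge> T \<Longrightarrow> A * C (nat \<lceil>t\<rceil>) * \<alpha>\<^sub>2 (norm x0) < \<alpha>\<^sub>1 (\<epsilon> / 2)"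
    for x0 T \<epsilon>
  proof -
    have "norm (x x0 t) \<le> \<epsilon> / 2" if t: "t \<ge> T" for t
    proof (rule ccontr)
      assume "\<not> norm (x x0 t) \<le> \<epsilon> / 2"
      then have "\<alpha>\<^sub>1 (\<epsilon> / 2) \<le> \<alpha>\<^sub>1 (norm (x x0 t))"
        using e by (intro class_K_infinityD(3)[OF K_inf(1)]) auto
      then show False using bound[of t x0] lt[OF t] t T by simp
    qed
    then have "(SUP t\<in>{T..}. ereal (norm (x x0 t))) \<le> ereal (\<epsilon> / 2)" by (intro SUP_least) simp
    also have "\<dots> < ereal \<epsilon>" using e by simp
    finally show ?thesis .
  qed
  have pos: "\<alpha>\<^sub>1 (\<epsilon> / 2) > 0" if "\<epsilon> > 0" for \<epsilon>
    using class_K_infinityD(2)[OF K_inf(1), of 0 "\<epsilon> / 2"] class_K_infinityD(1)[OF K_inf(1)] that by simp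
  have a2: "\<alpha>\<^sub>2 r \<ge> 0" if "r \<ge> 0" for r
    using class_K_infinityD(3)[OF K_inf(2), of 0 r] class_K_infinityD(1)[OF K_inf(2)] that by simp
  show "\<forall>\<epsilon>>0. \<exists>\<delta>>0. \<forall>x0. norm x0 < \<delta> \<longrightarrow> (SUP t\<in>{0..}. ereal (norm (x x0 t))) < ereal \<epsilon>"
  proof (intro allI impI)
    fix \<epsilon> :: real assume e: "\<epsilon> > 0"
    obtain Cm where Cm: "Cm > 0" "\<And>T. C T \<le> Cm"
    proof -
      have "Bseq C" using C(1) by (intro convergent_imp_Bseq convergentI)
      then obtain Cm where "Cm > 0" "\<And>T. norm (C T) \<le> Cm" by (auto elim: BseqE)
      then show thesis using that by (metis abs_le_D1 real_norm_def)
    qed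
    define \<eta> where "\<eta> = \<alpha>\<^sub>1 (\<epsilon> / 2) / (A * Cm)"
    have \<eta>: "\<eta> > 0" using pos[OF e] A Cm by (simp add: \<eta>_def)
    obtain \<delta> where \<delta>: "\<delta> > 0" "\<And>r. r \<in> {0..} \<Longrightarrow> dist r 0 < \<delta> \<Longrightarrow> dist (\<alpha>\<^sub>2 r) (\<alpha>\<^sub>2 0) < \<eta>"
      using class_K_infinityD(4)[OF K_inf(2)] \<eta> unfolding continuous_on_iff by (metis atLeast_iff order_refl)
    show "\<exists>\<delta>>0. \<forall>x0. norm x0 < \<delta> \<longrightarrow> (SUP t\<in>{0..}. ereal (norm (x x0 t))) < ereal \<epsilon>"
    proof (intro exI[of _ \<delta>] conjI allI impI \<delta>(1) small[OF e order_refl])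
      fix x0 t assume x0: "norm x0 < \<delta>"
      have "\<alpha>\<^sub>2 (norm x0) < \<eta>"
        using \<delta>(2)[of "norm x0"] x0 a2[of "norm x0"] class_K_infinityD(1)[OF K_inf(2)]
        by (simp add: dist_real_def)
      then have "A * Cm * \<alpha>\<^sub>2 (norm x0) < \<alpha>\<^sub>1 (\<epsilon> / 2)"
        using A Cm by (simp add: \<eta>_def field_simps)
      moreover have "A * C (nat \<lceil>t\<rceil>) * \<alpha>\<^sub>2 (norm x0) \<le> A * Cm * \<alpha>\<^sub>2 (norm x0)"
        using Cm A a2[of "norm x0"] by (intro mult_right_mono mult_left_mono) auto
      ultimately show "A * C (nat \<lceil>t\<rceil>) * \<alpha>\<^sub>2 (norm x0) < \<alpha>\<^sub>1 (\<epsilon> / 2)" by linarith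
    qed
  qed
  show "\<forall>r>0. \<forall>\<epsilon>>0. \<exists>T\<ge>0. \<forall>x0. norm x0 < r \<longrightarrow> (SUP t\<in>{T..}. ereal (norm (x x0 t))) < ereal \<epsilon>"
  proof (intro allI impI)
    fix r \<epsilon> :: real assume r: "r > 0" and e: "\<epsilon> > 0"
    have "(\<lambda>T. A * C T * \<alpha>\<^sub>2 r) \<longlonglongrightarrow> A * 0 * \<alpha>\<^sub>2 r" by (intro tendsto_intros C)
    then have "\<forall>\<^sub>F T in sequentially. A * C T * \<alpha>\<^sub>2 r < \<alpha>\<^sub>1 (\<epsilon> / 2)"
      using pos[OF e] by (intro order_tendstoD(2)) auto
    then obtain T0 where T0: "\<And>T. T \<ge> T0 \<Longrightarrow> A * C T * \<alpha>\<^sub>2 r < \<alpha>\<^sub>1 (\<epsilon> / 2)"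
      unfolding eventually_sequentially by blast
    show "\<exists>T\<ge>0. \<forall>x0. norm x0 < r \<longrightarrow> (SUP t\<in>{T..}. ereal (norm (x x0 t))) < ereal \<epsilon>"
    proof (intro exI[of _ "real T0"] conjI allI impI small[OF e])
      fix x0 t assume x0: "norm x0 < r" and t: "real T0 \<le> t"
      have "A * C (nat \<lceil>t\<rceil>) * \<alpha>\<^sub>2 (norm x0) \<le> A * C (nat \<lceil>t\<rceil>) * \<alpha>\<^sub>2 r"
        using class_K_infinityD(3)[OF K_inf(2), of "norm x0" r] x0 A C0 by (intro mult_left_mono) auto
      also have "\<dots> < \<alpha>\<^sub>1 (\<epsilon> / 2)" by (rule T0) (use t in linarith)
      finally show "A * C (nat \<lceil>t\<rceil>) * \<alpha>\<^sub>2 (norm x0) < \<alpha>\<^sub>1 (\<epsilon> / 2)" .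
    qed auto
  qed
qed

end

section \<open>Almost sure global asymptotic stability\<close>

theorem corollary3p20:
  fixes M :: "'w measure"
    and F :: "real \<Rightarrow> 'w measure"
    and \<sigma> :: "real \<Rightarrow> 'w \<Rightarrow> nat"
    and N :: nat
    and f :: "nat \<Rightarrow> real ^ 'n \<Rightarrow> real ^ 'n"
    and \<pi> :: "nat \<Rightarrow> real"
    and q :: "nat \<Rightarrow> nat \<Rightarrow> real"
    and V :: "nat \<Rightarrow> real ^ 'n \<Rightarrow> real"
    and \<alpha>\<^sub>1 \<alpha>\<^sub>2 :: "real \<Rightarrow> real"
    and lam \<mu> q_bar q_tilde :: real
  assumes "N \<ge> 1"
    and "prob_space M" and "complete_measure M"
    and "cadlag_process M N \<sigma>" and "natural_filtration M \<sigma> F"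
    and "markov_chain M N \<sigma> \<pi> q"
    and "\<forall>p\<in>{1..N}. local_lipschitz (UNIV :: real set) UNIV (\<lambda>_. f p)"
    and "\<forall>p\<in>{1..N}. f p 0 = 0"
    and "\<forall>K :: (real \<times> (real ^ 'n)) set. compact K \<and> K \<subseteq> {0..} \<times> UNIV \<longrightarrow>
           (\<exists>m :: real \<Rightarrow> real. m absolutely_integrable_on {0..} \<and>
              (\<forall>(t, x)\<in>K. (SUP p\<in>{1..N}. norm (f p x)) \<le> m t))"
    and "q_bar = Max ((\<lambda>i. \<bar>q i i\<bar>) ` {1..N})"
    and "q_tilde = Max ((\<lambda>(i, j). q i j) ` ({1..N} \<times> {1..N}))"
    and "\<forall>p\<in>{1..N}. continuously_differentiable (V p) \<and> (\<forall>x. V p x \<ge> 0)"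
    and "class_K_infinity \<alpha>\<^sub>1" and "class_K_infinity \<alpha>\<^sub>2"
    and "lam > 0" and "\<mu> > 1"
    and "\<forall>x. \<forall>p\<in>{1..N}. \<alpha>\<^sub>1 (norm x) \<le> V p x \<and> V p x \<le> \<alpha>\<^sub>2 (norm x)"
    and "\<forall>x. \<forall>p\<in>{1..N}. frechet_derivative (V p) (at x) (f p x) \<le> - lam * V p x"
    and "\<forall>x. \<forall>p\<^sub>1\<in>{1..N}. \<forall>p\<^sub>2\<in>{1..N}. V p\<^sub>1 x \<le> \<mu> * V p\<^sub>2 x"
    and "ereal \<mu> < ereal (lam + q_tilde) / ereal q_bar"
  shows "\<exists>x :: real ^ 'n \<Rightarrow> 'w \<Rightarrow> real \<Rightarrow> real ^ 'n.
           (\<forall>x0. \<forall>\<omega>\<in>space M. unique_caratheodory_solution f (\<lambda>t. \<sigma> t \<omega>) x0 (x x0 \<omega>)) \<and>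
           globally_asymptotically_stable_as M x"
proof -
  interpret M: prob_space M by fact
  let ?P = "{1..N}"
  define V' where "V' p z = frechet_derivative (V p) (at z)" for p z
  have gm: "generator_matrix N q" using assms(6) by (simp add: markov_chain_def)
  have offdiag: "q i j \<ge> 0" if "i \<in> ?P" "j \<in> ?P" "i \<noteq> j" for i j
    using gm that by (auto simp: generator_matrix_def)
  have rowsum: "(\<Sum>j\<in>?P - {i}. q i j) = - q i i" if "i \<in> ?P" for i
    using gm that by (auto simp: generator_matrix_def)
  have q_bar: "\<bar>q i i\<bar> \<le> q_bar" if "i \<in> ?P" for i
    unfolding assms(10) using that by (intro Max_ge) auto
  have q_bar0: "q_bar \<ge> 0" using q_bar[of 1] assms(1) by simp
  have le_q_bar: "q i j \<le> q_bar" if ij: "i \<in> ?P" "j \<in> ?P" for i j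
  proof (cases "i = j")
    case True
    then show ?thesis using q_bar[OF ij(1)] by simp
  next
    case False
    then have "q i j \<le> (\<Sum>j\<in>?P - {i}. q i j)"
      using ij offdiag by (intro member_le_sum) auto
    then show ?thesis using rowsum[OF ij(1)] q_bar[OF ij(1)] by simp
  qed
  have q_tilde: "q_tilde \<le> q_bar"
    unfolding assms(11) using le_q_bar assms(1) by (subst Max_le_iff) auto
  have rate: "(\<mu> - 1) * q_bar < lam"
  proof (cases "q_bar = 0")
    case True
    then show ?thesis using assms(15) by simp
  next
    case False
    then have "\<mu> < (lam + q_tilde) / q_bar" using assms(20) by simp
    then have "\<mu> * q_bar < lam + q_tilde" using False q_bar0 by (simp add: field_simps)
    then show ?thesis using q_tilde by (simp add: algebra_simps)
  qed
  \<comment> \<open>The rate bound must exceed \<open>q_bar\<close> strictly, to absorb the error term of the generator. This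
    choice puts \<open>(\<mu> - 1) * R\<close> halfway between \<open>(\<mu> - 1) * q_bar\<close> and \<open>lam\<close>.\<close>
  define R where "R = q_bar + (lam - (\<mu> - 1) * q_bar) / (2 * (\<mu> - 1))"
  have R: "q_bar < R" "(\<mu> - 1) * R < lam"
  proof -
    have pos: "\<mu> - 1 > 0" using assms(16) by simp
    then show "q_bar < R" using rate by (simp add: R_def)
    have half: "k * (d / (2 * k)) = d / 2" if "k > 0" for k d :: real using that by simp
    have "(\<mu> - 1) * R = (\<mu> - 1) * q_bar + (lam - (\<mu> - 1) * q_bar) / 2"
      unfolding R_def distrib_left half[OF pos] ..
    then show "(\<mu> - 1) * R < lam" using rate by (simp add: field_simps)
  qed
  have leave: "- q i i < R" if "i \<in> ?P" for i using q_bar[OF that] R(1) by simp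
  interpret lyapunov_family ?P f V V' \<alpha>\<^sub>1 \<alpha>\<^sub>2 lam \<mu>
  proof
    show "(V p has_derivative V' p z) (at z)" if "p \<in> ?P" for p z
      using assms(12) that frechet_derivative_works
      unfolding V'_def continuously_differentiable_def differentiable_def by blast
  qed (use assms in \<open>auto simp: V'_def\<close>)
  have step: "step_signal (\<lambda>t. \<sigma> t \<omega>)" if "\<omega> \<in> space M" for \<omega>
    by (rule cadlag_process_imp_step_signal[OF assms(4) that])
  have \<sigma>P: "\<sigma> t \<omega> \<in> ?P" if "\<omega> \<in> space M" "t \<ge> 0" for t \<omega>
    using assms(4) that measurable_space[of "\<sigma> t" M "count_space ?P"]
    unfolding cadlag_process_def by auto
  define x where "x x0 \<omega> = (SOME y. unique_caratheodory_solution f (\<lambda>t. \<sigma> t \<omega>) x0 y)" for x0 \<omega>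
  have x: "unique_caratheodory_solution f (\<lambda>t. \<sigma> t \<omega>) x0 (x x0 \<omega>)" if w: "\<omega> \<in> space M" for x0 \<omega>
    unfolding x_def using global_solution[OF step[OF w] \<sigma>P[OF w], of x0]
    by (intro someI_ex[where P = "unique_caratheodory_solution f (\<lambda>t. \<sigma> t \<omega>) x0"]) blast
  then have x': "caratheodory_solution f (\<lambda>t. \<sigma> t \<omega>) x0 (x x0 \<omega>)" if "\<omega> \<in> space M" for x0 \<omega>
    using that unfolding unique_caratheodory_solution_def by blast
  have growth: "AE \<omega> in M. \<exists>C. C \<longlonglongrightarrow> 0 \<and> (\<forall>T n0. \<exists>n\<ge>n0.
      \<mu> ^ grid_switches (\<lambda>t. \<sigma> t \<omega>) n (T * 2 ^ n) * exp (- lam * real T) \<le> C T)"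
    by (rule grid_switches_growth[OF assms(2,4,6) mu_ge_1 leave _ R(2)]) (use R(1) q_bar0 in auto)
  \<comment> \<open>The stability events quantify over uncountably many initial states and times, so their
    measurability comes from completeness.\<close>
  have prob1: "\<P>(\<omega> in M. Q \<omega>) = 1" if ae: "AE \<omega> in M. Q \<omega>" for Q
  proof -
    obtain Z where "Z \<in> null_sets M" "{\<omega> \<in> space M. \<not> Q \<omega>} \<subseteq> Z"
      using ae by (auto simp: eventually_ae_filter)
    then have "{\<omega> \<in> space M. \<not> Q \<omega>} \<in> sets M"
      using complete_measure.complete[OF assms(3)] by blast
    then have "space M - {\<omega> \<in> space M. \<not> Q \<omega>} \<in> sets M" by blast
    also have "space M - {\<omega> \<in> space M. \<not> Q \<omega>} = {\<omega> \<in> space M. Q \<omega>}" by blast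
    finally show ?thesis using ae by (simp add: M.prob_Collect_eq_1)
  qed
  have "globally_asymptotically_stable_as M x"
    unfolding globally_asymptotically_stable_as_def
  proof (intro conjI prob1)
    show "AE \<omega> in M. \<forall>\<epsilon>>0. \<exists>\<delta>>0. \<forall>x0. norm x0 < \<delta> \<longrightarrow>
        (SUP t\<in>{0..}. ereal (norm (x x0 \<omega> t))) < ereal \<epsilon>"
      using growth AE_space
    proof eventually_elim
      case (elim \<omega>)
      then obtain C where C: "C \<longlonglongrightarrow> 0" "\<And>T n0. \<exists>n\<ge>n0.
          \<mu> ^ grid_switches (\<lambda>t. \<sigma> t \<omega>) n (T * 2 ^ n) * exp (- lam * real T) \<le> C T" by blast
      show ?case
        by (rule pathwise_stability(1)[OF step[OF elim(2)] \<sigma>P[OF elim(2)] x'[OF elim(2)] C])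
    qed
    show "AE \<omega> in M. \<forall>r>0. \<forall>\<epsilon>>0. \<exists>T\<ge>0. \<forall>x0. norm x0 < r \<longrightarrow>
        (SUP t\<in>{T..}. ereal (norm (x x0 \<omega> t))) < ereal \<epsilon>"
      using growth AE_space
    proof eventually_elim
      case (elim \<omega>)
      then obtain C where C: "C \<longlonglongrightarrow> 0" "\<And>T n0. \<exists>n\<ge>n0.
          \<mu> ^ grid_switches (\<lambda>t. \<sigma> t \<omega>) n (T * 2 ^ n) * exp (- lam * real T) \<le> C T" by blast
      show ?case
        by (rule pathwise_stability(2)[OF step[OF elim(2)] \<sigma>P[OF elim(2)] x'[OF elim(2)] C])
    qed
  qed
  with x show ?thesis by blast
qed

end
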